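(* (1) For any generic triangular prism $P\subset\mathbb{R}^3$, $\mathcal{N}(P)\ge 10$. (2) For any generic tetrahedron $P\subset\mathbb{R}^3$, $\mathcal{N}(P)\ge 10$.
   Context: Polytopes are compact, convex, with non-empty interior. A triangular prism is a convex polytope combinatorially equivalent to the product of a triangle and a segment (six vertices, two triangular facets and three quadrilateral facets). For $y\in\mathrm{Int}\,P$, a normal to $\partial P$ emanating from $y$ is a segment $yz$ such that some support plane $h$ of $P$ satisfies $z\in h\cap P$ and $yz\perp h$. $n(P,y)$ is the number of normals emanating from $y$, and $\mathcal{N}(P)=\max_{y\in\mathrm{Int}\,P}n(P,y)$. Active regions and sheets: for a face $F$ of $P$ (vertex, edge or facet), let $o$ be a point in the relative interior of $F$ and $\mathrm{Cone}(F)=\{x\in\mathbb{R}^3:\langle p-o,x\rangle\ge0\ \forall p\in P\}$ (independent of $o$). The active region of $F$ is $\mathcal{AR}(F)=(\mathrm{Cone}(F)+F)\cap P$. The bifurcation set $\mathcal{B}(P)$ is the union of the boundaries of all active regions. Its linear pieces not lying on $\partial P$ are called sheets: the blue sheets are the side walls of the active regions of facets (i.e. for an edge $E$ of a facet $F$, the set $(E+\mathrm{Cone}(F))\cap P$), and the red sheets are the walls of the active regions of vertices (i.e. for an endpoint $V$ of an edge $E$, the set $(V+\mathrm{Cone}(E))\cap P$). A simple polytope $P\subset\mathbb{R}^3$ (each vertex has exactly three emanating edges) is generic if (i) no dihedral angle at an edge and no planar angle of a facet (angle of a facet at a vertex) is right, and (ii) the sheets of $\mathcal{B}(P)$ intersect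 (pairwise) transversally. *)

theory Defs
  imports "HOL-Analysis.Analysis"
begin

section \<open>Normals to the boundary of a polytope\<close>

definition support_plane :: "(real^3) set \<Rightarrow> (real^3) set \<Rightarrow> bool" where
  "support_plane P h \<longleftrightarrow>
     (\<exists>a b. a \<noteq> 0 \<and> h = {x. a \<bullet> x = b} \<and> P \<subseteq> {x. a \<bullet> x \<le> b}) \<and> h \<inter> P \<noteq> {}"

definition perp_to_plane :: "real^3 \<Rightarrow> real^3 \<Rightarrow> (real^3) set \<Rightarrow> bool" where
  "perp_to_plane y z h \<longleftrightarrow> (\<forall>u\<in>h. \<forall>v\<in>h. orthogonal (z - y) (u - v))"

text \<open>Meant for \<open>y\<close> in the interior of \<open>P\<close>; otherwise the degenerate segment may occur.\<close>

definition normals_from :: "(real^3) set \<Rightarrow> real^3 \<Rightarrow> (real^3) set set" where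
  "normals_from P y =
     {closed_segment y z | z. \<exists>h. support_plane P h \<and> z \<in> h \<inter> P \<and> perp_to_plane y z h}"

definition num_normals :: "(real^3) set \<Rightarrow> real^3 \<Rightarrow> nat" where
  "num_normals P y = card (normals_from P y)"

definition max_normals :: "(real^3) set \<Rightarrow> nat" where
  "max_normals P = Max (num_normals P ` interior P)"

section \<open>Tetrahedra and triangular prisms\<close>

definition solid_polytope :: "(real^3) set \<Rightarrow> bool" where
  "solid_polytope P \<longleftrightarrow> polytope P \<and> interior P \<noteq> {}"

definition combinatorially_equivalent ::
    "'a::euclidean_space set \<Rightarrow> 'b::euclidean_space set \<Rightarrow> bool" where
  "combinatorially_equivalent P Q \<longleftrightarrow>
     (\<exists>f. bij_betw f {F. F face_of P} {G. G face_of Q} \<and>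
          (\<forall>F F'. F face_of P \<longrightarrow> F' face_of P \<longrightarrow> (F \<subseteq> F' \<longleftrightarrow> f F \<subseteq> f F')))"

definition triangular_prism :: "(real^3) set \<Rightarrow> bool" where
  "triangular_prism P \<longleftrightarrow> solid_polytope P \<and>
     (\<exists>(T :: (real^2) set) (I :: real set).
        2 simplex T \<and> 1 simplex I \<and> combinatorially_equivalent P (T \<times> I))"

definition tetrahedron :: "(real^3) set \<Rightarrow> bool" where
  "tetrahedron P \<longleftrightarrow> 3 simplex P"

section \<open>Sheets of the bifurcation set\<close>

text \<open>Inner normals. For a nonempty face \<open>F\<close> of \<open>P\<close> the condition does not depend on the
  choice of \<open>c\<close> in the (nonempty) relative interior of \<open>F\<close>.\<close>

definition normal_cone :: "(real^3) set \<Rightarrow> (real^3) set \<Rightarrow> (real^3) set" where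
  "normal_cone P F = {x. \<forall>c\<in>rel_interior F. \<forall>p\<in>P. (p - c) \<bullet> x \<ge> 0}"

definition wall :: "(real^3) set \<Rightarrow> (real^3) set \<times> (real^3) set \<Rightarrow> (real^3) set" where
  "wall P = (\<lambda>(A, B). {a + x | a x. a \<in> A \<and> x \<in> normal_cone P B} \<inter> P)"

text \<open>The active region of a face \<open>F\<close> is \<open>(F + normal_cone P F) \<inter> P\<close>. A wall \<open>(A + normal_cone P B) \<inter> P\<close>
  lies on its boundary for \<open>F = B\<close> when \<open>(A, B)\<close> is an (edge, facet) pair, and for \<open>F = A\<close> when
  it is a (vertex, edge) pair. Sheets are handled through the pairs of faces that generate them, so that two sheets
  coming from different pairs count as different even if they coincide as sets.
  Walls contained in the boundary of \<open>P\<close> (for instance \<open>wall P (E, F)\<close> when the dihedral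
  angle at \<open>E\<close> is acute) are not sheets.\<close>

definition blue_sheets :: "(real^3) set \<Rightarrow> ((real^3) set \<times> (real^3) set) set" where
  "blue_sheets P = {(E, F). E edge_of P \<and> F facet_of P \<and> E \<subseteq> F \<and>
     \<not> wall P (E, F) \<subseteq> frontier P}"

definition red_sheets :: "(real^3) set \<Rightarrow> ((real^3) set \<times> (real^3) set) set" where
  "red_sheets P = {({v}, E) | v E. v extreme_point_of P \<and> E edge_of P \<and> v \<in> E \<and>
     \<not> wall P ({v}, E) \<subseteq> frontier P}"

definition directions :: "(real^3) set \<Rightarrow> (real^3) set" where
  "directions S = span {x - y | x y. x \<in> S \<and> y \<in> S}"

text \<open>For flat pieces the tangent space at every point is the space of directions.\<close>

definition meet_transversally :: "(real^3) set \<Rightarrow> (real^3) set \<Rightarrow> bool" where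
  "meet_transversally S T \<longleftrightarrow>
     S \<inter> T = {} \<or> {u + v | u v. u \<in> directions S \<and> v \<in> directions T} = UNIV"

section \<open>Generic polytopes\<close>

definition simple_polytope :: "(real^3) set \<Rightarrow> bool" where
  "simple_polytope P \<longleftrightarrow> solid_polytope P \<and>
     (\<forall>v. v extreme_point_of P \<longrightarrow> card {E. E edge_of P \<and> v \<in> E} = 3)"

text \<open>The dihedral angle is the angle between rays perpendicular to the edge that start at a
  common point \<open>z\<close> of the edge and lie in the two adjacent facets.\<close>

definition right_dihedral_angle :: "(real^3) set \<Rightarrow> (real^3) set \<Rightarrow> bool" where
  "right_dihedral_angle P E \<longleftrightarrow>
     (\<exists>F G z p q. F facet_of P \<and> G facet_of P \<and> F \<noteq> G \<and> E \<subseteq> F \<and> E \<subseteq> G \<and>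
        z \<in> E \<and> p \<in> F - E \<and> q \<in> G - E \<and>
        (\<forall>e\<in>E. orthogonal (p - z) (e - z) \<and> orthogonal (q - z) (e - z)) \<and>
        orthogonal (p - z) (q - z))"

definition right_planar_angle :: "(real^3) set \<Rightarrow> real^3 \<Rightarrow> bool" where
  "right_planar_angle F v \<longleftrightarrow>
     (\<exists>E E' p q. E edge_of F \<and> E' edge_of F \<and> E \<noteq> E' \<and> v \<in> E \<and> v \<in> E' \<and>
        p \<in> E - {v} \<and> q \<in> E' - {v} \<and> orthogonal (p - v) (q - v))"

definition generic :: "(real^3) set \<Rightarrow> bool" where
  "generic P \<longleftrightarrow> simple_polytope P \<and>
     (\<forall>E. E edge_of P \<longrightarrow> \<not> right_dihedral_angle P E) \<and>
     (\<forall>F v. F facet_of P \<longrightarrow> v extreme_point_of F \<longrightarrow> \<not> right_planar_angle F v) \<and>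
     pairwise (\<lambda>s t. meet_transversally (wall P s) (wall P t)) (blue_sheets P \<union> red_sheets P)"

end

theory Submission imports Defs begin

text \<open>The feet of the normals from \<open>y\<close> are the foot points of \<open>y\<close> on the faces whose active region contains
  \<open>y\<close>. Walls are crossed by active regions in pairs, both on the same side, so that along a generic ray the parity
  of the number of active regions is constant; far out on a ray in the inner normal cone of its vertex only that
  vertex is left. Counting the polytope itself as a face, the number is therefore odd.

  Suppose that all eight faces through a vertex \<open>V\<close> (\<open>P\<close> included) are active on the initial part of a ray from \<open>V\<close>.
  There a vertex \<open>W\<close> farthest from \<open>V\<close> is active as well. Moving away from \<open>V\<close>, the first of these nine to die
  does so together with a tenth, and parity turns \<open>10\<close> into \<open>11\<close>, that is, ten normals besides \<open>P\<close> itself. Such a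
  ray exists as soon as at most one planar angle at \<open>V\<close> is obtuse. If this failed everywhere, a
  tetrahedron would have \<open>8\<close> obtuse planar angles in its four triangles, and a prism \<open>12\<close>, although two
  triangles and three quadrilaterals have at most \<open>2 + 9\<close>.\<close>

section \<open>Coordinates relative to a family of normals\<close>

text \<open>Relative to a face \<open>J\<close> a point \<open>y\<close> is described by multipliers
  and slacks together: \<open>y\<close> minus its foot is a combination of the inner normals of
  \<open>J\<close>, and the foot has a slack in each facet outside \<open>J\<close>. Both kinds of
  coordinate are affine in \<open>y\<close>, and active means that all are positive. This symmetry
  reduces a wall to one index: where coordinate \<open>i\<close> vanishes, \<open>J\<close> and
  \<open>toggle i J\<close> have the same foot and the same coordinates, and the two gradients of
  coordinate \<open>i\<close> differ by a positive factor, which is why both regions lie on the same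
  side. The obstacle is that several coordinates of a face may vanish at once; since good directions
  form an open set, the ray can avoid the finitely many hyperplanes responsible. The tenth face must
  be new: two faces through \<open>V\<close> never share a wall on the ray, and Pythagoras excludes
  a wall between a face through \<open>V\<close> and the vertex \<open>W\<close>. Good directions
  come from the Gram matrices of the facet normals and of the edge vectors at \<open>V\<close>,
  which are inverse up to scaling.\<close>

text \<open>Linear independence of the indexed family, repetitions excluded, in the form in which it
  is used: for each index some vector sees exactly that normal.\<close>

definition dual_family :: "('i \<Rightarrow> 'a::euclidean_space) \<Rightarrow> 'i set \<Rightarrow> bool" where
  "dual_family n J \<longleftrightarrow> finite J \<and> (\<forall>j\<in>J. \<exists>w. \<forall>k\<in>J. n k \<bullet> w = of_bool (k = j))"

text \<open>Membership in the span makes the choice unique; otherwise it would be determined only up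
  to the orthogonal complement.\<close>

definition dual_vec :: "('i \<Rightarrow> 'a::euclidean_space) \<Rightarrow> 'i set \<Rightarrow> 'i \<Rightarrow> 'a" where
  "dual_vec n J j = (SOME w. w \<in> span (n ` J) \<and> (\<forall>k\<in>J. n k \<bullet> w = of_bool (k = j)))"

text \<open>For a dual family this is the orthogonal projection onto the complement of the span of
  the \<open>n j\<close>.\<close>

definition residual :: "('i \<Rightarrow> 'a::euclidean_space) \<Rightarrow> 'i set \<Rightarrow> 'a \<Rightarrow> 'a" where
  "residual n J v = v - (\<Sum>j\<in>J. (dual_vec n J j \<bullet> v) *\<^sub>R n j)"

lemma dual_family_subset: "dual_family n J \<Longrightarrow> K \<subseteq> J \<Longrightarrow> dual_family n K"
  unfolding dual_family_def by (meson finite_subset subsetD)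

lemma dual_vec:
  assumes "dual_family n J" "j \<in> J"
  shows "dual_vec n J j \<in> span (n ` J)" "\<And>k. k \<in> J \<Longrightarrow> n k \<bullet> dual_vec n J j = of_bool (k = j)"
proof -
  obtain w where w: "\<forall>k\<in>J. n k \<bullet> w = of_bool (k = j)"
    using assms unfolding dual_family_def by blast
  obtain p q where p: "p \<in> span (n ` J)" and q: "\<And>x. x \<in> span (n ` J) \<Longrightarrow> orthogonal q x" and "w = p + q"
    using orthogonal_subspace_decomp_exists[of "n ` J" w] by metis
  have "n k \<bullet> p = of_bool (k = j)" if "k \<in> J" for k
  proof -
    have "orthogonal q (n k)" using q that by (simp add: span_base)
    then show ?thesis
      using w that \<open>w = p + q\<close> inner_commute[of q "n k"] by (auto simp: orthogonal_def inner_add_right)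
  qed
  with p have "\<exists>w. w \<in> span (n ` J) \<and> (\<forall>k\<in>J. n k \<bullet> w = of_bool (k = j))" by blast
  from someI_ex[OF this]
  show "dual_vec n J j \<in> span (n ` J)" "\<And>k. k \<in> J \<Longrightarrow> n k \<bullet> dual_vec n J j = of_bool (k = j)"
    unfolding dual_vec_def by blast+
qed

lemma inner_span_eq_0:
  assumes "x \<in> span (n ` J)" "\<And>j. j \<in> J \<Longrightarrow> n j \<bullet> v = 0"
  shows "x \<bullet> v = 0"
  using assms(1) by (induction rule: span_induct_alt) (auto simp: inner_add_left assms(2))

text \<open>The difference of the two sides lies in the span and is orthogonal to every
  \<open>n k\<close>, hence to itself. It yields that residuals are orthogonal to the
  family.\<close>

lemma dual_vec_reflects:
  assumes "dual_family n J" "i \<in> J"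
  shows "(\<Sum>j\<in>J. (n i \<bullet> n j) *\<^sub>R dual_vec n J j) = n i"
proof -
  let ?d = "(\<Sum>j\<in>J. (n i \<bullet> n j) *\<^sub>R dual_vec n J j) - n i"
  have fin: "finite J" using assms by (simp add: dual_family_def)
  have "n k \<bullet> ?d = 0" if "k \<in> J" for k
  proof -
    have "n k \<bullet> (\<Sum>j\<in>J. (n i \<bullet> n j) *\<^sub>R dual_vec n J j) = (\<Sum>j\<in>J. (n i \<bullet> n j) * of_bool (k = j))"
      using assms that by (simp add: inner_sum_right dual_vec)
    also have "\<dots> = n i \<bullet> n k"
      using fin that by (simp add: of_bool_def if_distrib sum.delta cong: if_cong)
    finally show ?thesis by (simp add: inner_diff_right inner_commute)
  qed
  moreover have "?d \<in> span (n ` J)"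
    using assms by (intro span_diff span_sum span_scale dual_vec span_base) auto
  ultimately have "?d \<bullet> ?d = 0" by (rule inner_span_eq_0[rotated])
  then show ?thesis by simp
qed

lemma inner_residual:
  "n i \<bullet> residual n J v = (n i - (\<Sum>j\<in>J. (n i \<bullet> n j) *\<^sub>R dual_vec n J j)) \<bullet> v"
  by (simp add: residual_def inner_diff_right inner_diff_left inner_sum_left inner_sum_right mult.commute)

lemma inner_residual_eq_0: "dual_family n J \<Longrightarrow> i \<in> J \<Longrightarrow> n i \<bullet> residual n J v = 0"
  by (simp add: inner_residual dual_vec_reflects)

lemma residual_decomp: "v = residual n J v + (\<Sum>j\<in>J. (dual_vec n J j \<bullet> v) *\<^sub>R n j)"
  by (simp add: residual_def)

text \<open>Pairing with the dual vectors reads off the coefficients, so any decomposition of this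
  kind is the canonical one. Feet and multipliers are later identified by guessing a
  decomposition.\<close>

lemma residual_unique:
  assumes "dual_family n J" "v = x + (\<Sum>j\<in>J. c j *\<^sub>R n j)" "\<And>j. j \<in> J \<Longrightarrow> n j \<bullet> x = 0"
  shows "residual n J v = x" "\<And>j. j \<in> J \<Longrightarrow> dual_vec n J j \<bullet> v = c j"
proof -
  have fin: "finite J" using assms by (simp add: dual_family_def)
  show c: "dual_vec n J j \<bullet> v = c j" if "j \<in> J" for j
  proof -
    have "dual_vec n J j \<bullet> x = 0"
      by (rule inner_span_eq_0[of _ n J]) (simp_all add: assms dual_vec that)
    moreover have "dual_vec n J j \<bullet> n k = of_bool (k = j)" if "k \<in> J" for k
      using dual_vec(2)[OF assms(1) \<open>j \<in> J\<close> that] by (simp add: inner_commute)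
    then have "(\<Sum>k\<in>J. c k * (dual_vec n J j \<bullet> n k)) = (\<Sum>k\<in>J. if k = j then c k else 0)"
      by (intro sum.cong) auto
    ultimately show ?thesis
      using fin that by (simp add: assms(2) inner_add_right inner_sum_right)
  qed
  show "residual n J v = x"
    unfolding residual_def using assms(2) c by (metis (no_types, lifting) add_diff_cancel_right' sum.cong)
qed

lemma residual_add: "residual n J (v + w) = residual n J v + residual n J w"
  by (simp add: residual_def inner_add_right scaleR_add_left sum.distrib)

lemma residual_scale: "residual n J (c *\<^sub>R v) = c *\<^sub>R residual n J v"
  by (simp add: residual_def scaleR_sum_right scaleR_diff_right)

lemma residual_of_orthogonal:
  assumes "dual_family n J" "\<And>j. j \<in> J \<Longrightarrow> n j \<bullet> v = 0"
  shows "residual n J v = v" "\<And>j. j \<in> J \<Longrightarrow> dual_vec n J j \<bullet> v = 0"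
  using residual_unique[OF assms(1), of v v "\<lambda>_. 0"] assms(2) by auto

lemma residual_of_member:
  assumes "dual_family n J" "i \<in> J"
  shows "residual n J (n i) = 0" "\<And>j. j \<in> J \<Longrightarrow> dual_vec n J j \<bullet> n i = of_bool (j = i)"
proof -
  have "finite J" using assms by (simp add: dual_family_def)
  moreover have "(\<Sum>j\<in>J. of_bool (j = i) *\<^sub>R n j) = (\<Sum>j\<in>J. if j = i then n j else 0)"
    by (intro sum.cong) auto
  ultimately have "n i = 0 + (\<Sum>j\<in>J. of_bool (j = i) *\<^sub>R n j)"
    using assms(2) by simp
  from residual_unique[OF assms(1) this]
  show "residual n J (n i) = 0" "\<And>j. j \<in> J \<Longrightarrow> dual_vec n J j \<bullet> n i = of_bool (j = i)" by auto
qed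

text \<open>Gradient in \<open>y\<close> of the coordinate \<open>i\<close> relative to the face \<open>J\<close>: a multiplier
  for \<open>i \<in> J\<close>, a slack of the foot of \<open>y\<close> otherwise.\<close>

definition coord_lin :: "('i \<Rightarrow> 'a::euclidean_space) \<Rightarrow> 'i set \<Rightarrow> 'i \<Rightarrow> 'a \<Rightarrow> real" where
  "coord_lin n J i v = (if i \<in> J then dual_vec n J i \<bullet> v else n i \<bullet> residual n J v)"

definition coord_grad :: "('i \<Rightarrow> 'a::euclidean_space) \<Rightarrow> 'i set \<Rightarrow> 'i \<Rightarrow> 'a" where
  "coord_grad n J i = (if i \<in> J then dual_vec n J i else n i - (\<Sum>j\<in>J. (n i \<bullet> n j) *\<^sub>R dual_vec n J j))"

lemma coord_lin_grad: "coord_lin n J i v = coord_grad n J i \<bullet> v"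
  by (simp add: coord_lin_def coord_grad_def inner_residual)

text \<open>The factor is the squared length of the component of \<open>n i\<close> orthogonal to
  the span of \<open>J\<close>. Its positivity puts the active regions of \<open>J\<close> and
  \<open>insert i J\<close> on the same side of their common wall.\<close>

lemma coord_lin_insert:
  assumes "dual_family n (insert i J)" "i \<notin> J"
  shows "\<exists>c>0. \<forall>v. coord_lin n J i v = c * coord_lin n (insert i J) i v"
proof (intro exI conjI allI)
  let ?c = "n i \<bullet> residual n J (n i)"
  have J: "dual_family n J" using assms by (blast intro: dual_family_subset)
  have fin: "finite J" using J by (simp add: dual_family_def)
  have eq: "n i \<bullet> residual n J v = ?c * (dual_vec n (insert i J) i \<bullet> v)" for v
  proof -
    let ?r = "residual n (insert i J) v"
    let ?m = "\<lambda>j. dual_vec n (insert i J) j \<bullet> v"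
    \<comment> \<open>Applying \<open>residual n J\<close> to the expansion over
      \<open>insert i J\<close> kills the part in \<open>J\<close> and fixes \<open>?r\<close>; only
      the term along \<open>n i\<close> changes.\<close>
    have "v = (?r + ?m i *\<^sub>R n i) + (\<Sum>j\<in>J. ?m j *\<^sub>R n j)"
      using residual_decomp[of v n "insert i J"] assms(2) fin by (simp add: add_ac)
    moreover have "residual n J (\<Sum>j\<in>J. ?m j *\<^sub>R n j) = 0"
      by (rule residual_unique(1)[OF J, of _ 0 ?m]) simp_all
    ultimately have res: "residual n J v = residual n J ?r + ?m i *\<^sub>R residual n J (n i)"
      using residual_add[of n J "?r + ?m i *\<^sub>R n i" "\<Sum>j\<in>J. ?m j *\<^sub>R n j"]
      by (simp only: residual_add residual_scale add.right_neutral)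
    have "residual n J ?r = ?r"
      using assms by (intro residual_of_orthogonal(1) J) (simp add: inner_residual_eq_0)
    moreover have "n i \<bullet> ?r = 0" using assms by (simp add: inner_residual_eq_0)
    ultimately show ?thesis using res by (simp add: inner_add_right)
  qed
  show "coord_lin n J i v = ?c * coord_lin n (insert i J) i v" for v
    unfolding coord_lin_def using assms(2) eq[of v] by simp
  \<comment> \<open>The dual vector is fixed by \<open>residual n J\<close>, so testing with it
    gives factor times squared length equal to 1.\<close>
  let ?w = "dual_vec n (insert i J) i"
  have "residual n J ?w = ?w"
    using assms by (intro residual_of_orthogonal(1) J) (auto simp: dual_vec)
  then have "n i \<bullet> residual n J ?w = 1" using assms by (simp add: dual_vec)
  with eq[of ?w] have "?c * (?w \<bullet> ?w) = 1" by simp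
  then show "?c > 0"
    using mult_nonpos_nonneg[of ?c "?w \<bullet> ?w"] by (cases "?c > 0") auto
qed

section \<open>Parity of a system of cells along a ray\<close>

text \<open>A nonempty open set minus a hyperplane is again open and nonempty, so the hyperplanes
  can be removed one after another.\<close>

lemma exists_generic_vector:
  fixes U :: "'a::euclidean_space set"
  assumes "finite A" "0 \<notin> A" "open U" "U \<noteq> {}"
  shows "\<exists>u\<in>U. \<forall>a\<in>A. a \<bullet> u \<noteq> 0"
  using assms
proof (induction arbitrary: U)
  case empty
  then show ?case by auto
next
  case (insert a A)
  have "open (U \<inter> {u. a \<bullet> u \<noteq> 0})"
    by (intro open_Int insert.prems open_Collect_neq continuous_intros)
  moreover have "U \<inter> {u. a \<bullet> u \<noteq> 0} \<noteq> {}"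
  proof -
    obtain u where u: "u \<in> U" using insert.prems by auto
    then obtain e where e: "e > 0" "ball u e \<subseteq> U" using insert.prems openE by blast
    have a: "a \<noteq> 0" using insert.prems by auto
    let ?w = "u + (e / 2 / norm a) *\<^sub>R a"
    have "?w \<in> U" using e a by (intro subsetD[OF e(2)]) (simp add: dist_norm)
    moreover have "a \<bullet> ?w \<noteq> 0" if "a \<bullet> u = 0"
      using that e a by (simp add: inner_add_right)
    ultimately show ?thesis using u by blast
  qed
  ultimately obtain u where "u \<in> U \<inter> {u. a \<bullet> u \<noteq> 0}" "\<forall>a\<in>A. a \<bullet> u \<noteq> 0"
    using insert.IH insert.prems by (metis insertCI)
  then show ?case by auto
qed

definition toggle :: "'i \<Rightarrow> 'i set \<Rightarrow> 'i set" where
  "toggle i J = (if i \<in> J then J - {i} else insert i J)"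

lemma toggle_toggle [simp]: "toggle i (toggle i J) = J"
  by (auto simp: toggle_def)

lemma mem_toggle [simp]: "i \<in> toggle i J \<longleftrightarrow> i \<notin> J"
  by (auto simp: toggle_def)

text \<open>Each wall is crossed by exactly the two cells \<open>J\<close> and \<open>toggle i J\<close>, and both lie on the
  same side of it.\<close>

lemma parity_of_cells_constant:
  fixes \<alpha> \<beta> :: "'i set \<Rightarrow> 'i \<Rightarrow> real"
  assumes finF: "finite F" and finI: "finite I"
    and wall: "\<And>t J i. \<lbrakk>0 < t; J \<in> F; \<forall>k\<in>I. \<alpha> J k + t * \<beta> J k \<ge> 0; i \<in> I; \<alpha> J i + t * \<beta> J i = 0\<rbrakk>
        \<Longrightarrow> \<beta> J i \<noteq> 0 \<and> (\<forall>k\<in>I - {i}. \<alpha> J k + t * \<beta> J k \<noteq> 0)"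
    and swap: "\<And>t J i. \<lbrakk>0 < t; J \<in> F; \<forall>k\<in>I. \<alpha> J k + t * \<beta> J k \<ge> 0; i \<in> I; \<alpha> J i + t * \<beta> J i = 0\<rbrakk>
        \<Longrightarrow> toggle i J \<in> F \<and> \<beta> J i * \<beta> (toggle i J) i \<ge> 0 \<and>
          (\<forall>k\<in>I. \<alpha> (toggle i J) k + t * \<beta> (toggle i J) k = \<alpha> J k + t * \<beta> J k)"
    and "0 < s" "0 < t"
  shows "even (card {J\<in>F. \<forall>i\<in>I. \<alpha> J i + s * \<beta> J i > 0}) =
    even (card {J\<in>F. \<forall>i\<in>I. \<alpha> J i + t * \<beta> J i > 0})"
proof -
  define \<phi> where "\<phi> J i t = \<alpha> J i + t * \<beta> J i" for J i t
  define N where "N t = {J\<in>F. \<forall>i\<in>I. \<phi> J i t > 0}" for t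
  \<comment> \<open>The parity is shown to be locally constant at each \<open>t > 0\<close>;
    connectedness of the half-line does the rest.\<close>
  have "eventually (\<lambda>s. even (card (N t)) = even (card (N s))) (at t within {0<..})"
    if t: "t \<in> {0<..}" for t
  proof -
    \<comment> \<open>\<open>C\<close> consists of the cells on whose boundary the point at time
      \<open>t\<close> lies; \<open>z J\<close> is the vanishing coordinate, unique by
      \<open>wall\<close>.\<close>
    define C where "C = {J\<in>F. (\<forall>i\<in>I. \<phi> J i t \<ge> 0) \<and> (\<exists>i\<in>I. \<phi> J i t = 0)}"
    define z where "z J = (SOME i. i \<in> I \<and> \<phi> J i t = 0)" for J
    have z: "z J \<in> I" "\<phi> J (z J) t = 0" if "J \<in> C" for J
      using someI_ex[of "\<lambda>i. i \<in> I \<and> \<phi> J i t = 0"] that unfolding z_def C_def by auto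
    have zw: "\<beta> J (z J) \<noteq> 0" "\<And>k. k \<in> I \<Longrightarrow> k \<noteq> z J \<Longrightarrow> \<phi> J k t > 0" if "J \<in> C" for J
    proof -
      have pos: "\<forall>k\<in>I. \<phi> J k t \<ge> 0" "J \<in> F" using that by (auto simp: C_def)
      have *: "\<beta> J (z J) \<noteq> 0 \<and> (\<forall>k\<in>I - {z J}. \<phi> J k t \<noteq> 0)"
        using wall[of t J "z J"] z[OF that] pos t by (auto simp: \<phi>_def)
      then show "\<beta> J (z J) \<noteq> 0" by simp
      show "\<phi> J k t > 0" if "k \<in> I" "k \<noteq> z J" for k
        using * pos that by (metis DiffI order_less_le singletonD)
    qed
    have tog: "toggle (z J) J \<in> C" "z (toggle (z J) J) = z J" "\<beta> J (z J) * \<beta> (toggle (z J) J) (z J) > 0"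
      if J: "J \<in> C" for J
    proof -
      have pos: "\<forall>k\<in>I. \<phi> J k t \<ge> 0" "J \<in> F" using that by (auto simp: C_def)
      have *: "toggle (z J) J \<in> F" "\<beta> J (z J) * \<beta> (toggle (z J) J) (z J) \<ge> 0"
        "\<forall>k\<in>I. \<phi> (toggle (z J) J) k t = \<phi> J k t"
        using swap[of t J "z J"] z[OF that] pos t by (auto simp: \<phi>_def)
      show C: "toggle (z J) J \<in> C" using * pos z[OF J] by (auto simp: C_def)
      have "\<phi> J (z (toggle (z J) J)) t = 0" using z[OF C] * by auto
      then show eq: "z (toggle (z J) J) = z J" using zw(2)[OF J] z[OF C] by force
      show "\<beta> J (z J) * \<beta> (toggle (z J) J) (z J) > 0"
        using * zw(1)[OF J] zw(1)[OF C] eq by (simp add: order_less_le)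
    qed
    \<comment> \<open>\<open>toggle (z J)\<close> pairs the cells of \<open>C\<close> without fixed
      points and keeps the sign of the slope, so on each side of \<open>t\<close> an even number is
      active. The factor \<open>c\<close> will be \<open>s - t\<close>, of which only the sign
      matters.\<close>
    have ev: "even (card {J\<in>C. c * \<beta> J (z J) > 0})" for c
    proof -
      let ?X = "{J\<in>C. c * \<beta> J (z J) > 0 \<and> z J \<in> J}"
      let ?Y = "{J\<in>C. c * \<beta> J (z J) > 0 \<and> z J \<notin> J}"
      have sgn: "c * \<beta> (toggle (z J) J) (z J) > 0" if "J \<in> C" "c * \<beta> J (z J) > 0" for J
        using tog(3)[OF that(1)] that(2) by (auto simp: zero_less_mult_iff)
      have "bij_betw (\<lambda>J. toggle (z J) J) ?X ?Y"
        by (rule bij_betw_byWitness[where f' = "\<lambda>J. toggle (z J) J"]) (auto simp: tog sgn)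
      then have "card ?X = card ?Y" by (rule bij_betw_same_card)
      moreover have "finite ?X" "finite ?Y" using finF by (auto simp: C_def)
      then have "card (?X \<union> ?Y) = card ?X + card ?Y" by (intro card_Un_disjoint) auto
      moreover have "{J\<in>C. c * \<beta> J (z J) > 0} = ?X \<union> ?Y" by auto
      ultimately show ?thesis by simp
    qed
    have tend: "((\<lambda>s. \<phi> J i s) \<longlongrightarrow> \<phi> J i t) (at t within {0<..})" for J i
      unfolding \<phi>_def by (intro tendsto_intros)
    have "eventually (\<lambda>s. (\<phi> J i t > 0 \<longrightarrow> \<phi> J i s > 0) \<and> (\<phi> J i t < 0 \<longrightarrow> \<phi> J i s < 0))
        (at t within {0<..})" for J i
      using order_tendstoD[OF tend[of J i], of 0]
      by (cases "\<phi> J i t" "0::real" rule: linorder_cases) (auto elim: eventually_mono)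
    then have "eventually (\<lambda>s. \<forall>J\<in>F. \<forall>i\<in>I. (\<phi> J i t > 0 \<longrightarrow> \<phi> J i s > 0) \<and> (\<phi> J i t < 0 \<longrightarrow> \<phi> J i s < 0))
        (at t within {0<..})"
      using finF finI by (simp add: eventually_ball_finite)
    moreover have "eventually (\<lambda>s. s \<noteq> t) (at t within {0<..})"
      by (simp add: eventually_at_filter)
    ultimately show ?thesis
    proof eventually_elim
      case (elim s)
      have \<phi>: "\<phi> J i s = \<phi> J i t + (s - t) * \<beta> J i" for J i
        by (simp add: \<phi>_def algebra_simps)
      \<comment> \<open>Near \<open>t\<close> a cell outside \<open>C\<close> keeps its status,
        while a cell of \<open>C\<close> is active exactly on the side where its vanishing
        coordinate becomes positive; at \<open>t\<close> itself it is not counted.\<close>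
      have split: "J \<in> N s \<longleftrightarrow> J \<in> N t \<union> {J\<in>C. (s - t) * \<beta> J (z J) > 0}" if "J \<in> F" for J
      proof -
        consider i where "i \<in> I" "\<phi> J i t < 0" | "J \<in> N t" | "J \<in> C"
        proof (cases "\<exists>i\<in>I. \<phi> J i t < 0")
          case False
          then have "\<forall>i\<in>I. \<phi> J i t \<ge> 0" by (auto simp: not_less)
          moreover from this have "J \<in> N t" if "\<not> (\<exists>i\<in>I. \<phi> J i t = 0)"
            using that \<open>J \<in> F\<close> by (force simp: N_def order_less_le)
          ultimately show ?thesis using that \<open>J \<in> F\<close> by (auto simp: C_def)
        qed auto
        then show ?thesis
        proof cases
          case 1
          then have "\<phi> J i s < 0" using elim that by auto
          with 1 have "J \<notin> N s" "J \<notin> N t" "J \<notin> C" by (fastforce simp: N_def C_def)+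
          then show ?thesis by auto
        next
          case 2
          then show ?thesis using elim that by (auto simp: N_def)
        next
          case 3
          then have "J \<notin> N t" using z by (force simp: N_def)
          moreover have "J \<in> N s \<longleftrightarrow> \<phi> J (z J) s > 0"
            using 3 z[OF 3] zw[OF 3] elim that unfolding N_def by auto
          ultimately show ?thesis using 3 z[OF 3] by (simp add: \<phi>)
        qed
      qed
      then have "N s = N t \<union> {J\<in>C. (s - t) * \<beta> J (z J) > 0}"
        by (auto simp: N_def C_def)
      moreover have "N t \<inter> {J\<in>C. (s - t) * \<beta> J (z J) > 0} = {}"
        using z by (force simp: N_def)
      moreover have "finite (N t)" "finite C" using finF by (auto simp: N_def C_def)
      ultimately have "card (N s) = card (N t) + card {J\<in>C. (s - t) * \<beta> J (z J) > 0}"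
        by (simp add: card_Un_disjoint)
      then show ?case using ev by simp
    qed
  qed
  then have "even (card (N s)) = even (card (N t))"
    using assms(5,6) by (intro connected_local_const[of "{0<..}"]) auto
  then show ?thesis by (simp add: N_def \<phi>_def)
qed

section \<open>Simple polytopes and their active regions\<close>

text \<open>Faces are encoded by the sets \<open>J\<close> of facets that contain them, the polytope itself being \<open>J = {}\<close>.\<close>

locale facet_system =
  fixes I :: "'i set" and n :: "'i \<Rightarrow> 'a::euclidean_space" and b :: "'i \<Rightarrow> real" and P :: "'a set"
  assumes finite_I: "finite I"
    and P_eq: "P = {x. \<forall>i\<in>I. b i \<le> n i \<bullet> x}"
begin

definition act :: "'a \<Rightarrow> 'i set" where
  "act x = {i\<in>I. n i \<bullet> x = b i}"

lemma in_P_iff: "x \<in> P \<longleftrightarrow> (\<forall>i\<in>I. b i \<le> n i \<bullet> x)"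
  by (simp add: P_eq)

lemma feasible_direction:
  assumes "x \<in> P" "\<And>i. i \<in> act x \<Longrightarrow> n i \<bullet> w \<ge> 0"
  shows "\<exists>e>0. x + e *\<^sub>R w \<in> P"
proof -
  have "eventually (\<lambda>e. n i \<bullet> (x + e *\<^sub>R w) \<ge> b i) (at_right 0)" if i: "i \<in> I" for i
  proof (cases "i \<in> act x")
    case True
    have "eventually (\<lambda>e::real. e > 0) (at_right 0)" by (simp add: eventually_at_right_less)
    then show ?thesis
      by eventually_elim (use True assms(2) in \<open>auto simp: act_def inner_add_right\<close>)
  next
    case False
    then have "n i \<bullet> (x + 0 *\<^sub>R w) > b i" using i assms(1) by (force simp: act_def in_P_iff order_less_le)
    moreover have "((\<lambda>e. n i \<bullet> (x + e *\<^sub>R w)) \<longlongrightarrow> n i \<bullet> (x + 0 *\<^sub>R w)) (at_right 0)"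
      by (intro tendsto_intros)
    ultimately have "eventually (\<lambda>e. n i \<bullet> (x + e *\<^sub>R w) > b i) (at_right 0)" by (simp add: order_tendstoD)
    then show ?thesis by eventually_elim simp
  qed
  then have "eventually (\<lambda>e. x + e *\<^sub>R w \<in> P) (at_right 0)"
    using finite_I by (simp add: in_P_iff eventually_ball_finite)
  moreover have "eventually (\<lambda>e::real. e > 0) (at_right 0)" by (simp add: eventually_at_right_less)
  ultimately have "eventually (\<lambda>e. e > 0 \<and> x + e *\<^sub>R w \<in> P) (at_right 0)" by eventually_elim simp
  then show ?thesis using eventually_happens' trivial_limit_at_right_real by blast
qed

text \<open>Otherwise \<open>v\<close> and its opposite are both feasible and \<open>x\<close> is
  inside a segment of \<open>P\<close>; the weight \<open>s\<close> balances the two step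
  lengths.\<close>

lemma extreme_point_full:
  assumes "x extreme_point_of P" "\<And>i. i \<in> act x \<Longrightarrow> n i \<bullet> v = 0"
  shows "v = 0"
proof (rule ccontr)
  assume "v \<noteq> 0"
  have x: "x \<in> P" using assms(1) by (simp add: extreme_point_of_def)
  obtain e where e: "e > 0" "x + e *\<^sub>R v \<in> P" using feasible_direction[OF x, of v] assms(2) by auto
  obtain e' where e': "e' > 0" "x + e' *\<^sub>R (- v) \<in> P" using feasible_direction[OF x, of "- v"] assms(2) by auto
  define s where "s = e / (e + e')"
  have s: "0 < s" "s < 1" "(1 - s) * e - s * e' = 0" using e e' by (auto simp: s_def field_simps)
  have "(1 - s) *\<^sub>R (x + e *\<^sub>R v) + s *\<^sub>R (x + e' *\<^sub>R (- v)) = x + ((1 - s) * e - s * e') *\<^sub>R v"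
    by (simp add: algebra_simps)
  then have "x = (1 - s) *\<^sub>R (x + e *\<^sub>R v) + s *\<^sub>R (x + e' *\<^sub>R (- v))" using s by simp
  moreover have "x + e *\<^sub>R v \<noteq> x + e' *\<^sub>R (- v)"
  proof
    assume "x + e *\<^sub>R v = x + e' *\<^sub>R (- v)"
    then have "(e + e') *\<^sub>R v = 0" by (simp add: algebra_simps)
    then show False using \<open>v \<noteq> 0\<close> e e' by simp
  qed
  ultimately have "x \<in> open_segment (x + e *\<^sub>R v) (x + e' *\<^sub>R (- v))"
    unfolding in_segment using s by blast
  then show False using assms(1) e e' by (auto simp: extreme_point_of_def)
qed

end

locale simple_system = facet_system I n b P
  for I :: "'i set" and n :: "'i \<Rightarrow> 'a::euclidean_space" and b P +
  assumes bounded_P: "bounded P"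
    and simple: "\<And>x. x \<in> P \<Longrightarrow> dual_family n (act x)"
begin

text \<open>Asking for a subset of \<open>act x\<close> rather than equality makes closure under
  removal of facets immediate, as toggling requires.\<close>

definition cells :: "'i set set" where
  "cells = {J. \<exists>x\<in>P. J \<subseteq> act x}"

definition base :: "'i set \<Rightarrow> 'a" where
  "base J = (SOME x. x \<in> P \<and> J \<subseteq> act x)"

text \<open>Orthogonal projection of \<open>y\<close> to the flat cut out by the facets in
  \<open>J\<close>; it may fall outside \<open>P\<close>. For cells the choice of
  \<open>base J\<close> is immaterial by \<open>foot_unique\<close>.\<close>

definition foot :: "'i set \<Rightarrow> 'a \<Rightarrow> 'a" where
  "foot J y = base J + residual n J (y - base J)"

text \<open>Nonnegativity of all coordinates is the Karush-Kuhn-Tucker condition: the foot lies in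
  \<open>P\<close>, and \<open>y\<close> minus the foot lies in the cone of the inner normals of
  \<open>J\<close>.\<close>

definition crd :: "'i set \<Rightarrow> 'i \<Rightarrow> 'a \<Rightarrow> real" where
  "crd J i y = (if i \<in> J then dual_vec n J i \<bullet> (y - base J) else n i \<bullet> foot J y - b i)"

lemma base: "J \<in> cells \<Longrightarrow> base J \<in> P \<and> J \<subseteq> act (base J)"
  unfolding base_def cells_def by (rule someI_ex) auto

lemma cells_subset: "J \<in> cells \<Longrightarrow> J \<subseteq> I"
  by (auto simp: cells_def act_def)

lemma finite_cells: "finite cells"
  using finite_I cells_subset by (meson PowI finite_Pow_iff rev_finite_subset subsetI)

lemma act_in_cells: "x \<in> P \<Longrightarrow> act x \<in> cells"
  by (auto simp: cells_def)

lemma dual_cells: "J \<in> cells \<Longrightarrow> dual_family n J"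
  using dual_family_subset simple unfolding cells_def by blast

lemma inner_base: "J \<in> cells \<Longrightarrow> j \<in> J \<Longrightarrow> n j \<bullet> base J = b j"
  using base by (auto simp: act_def)

lemma inner_foot: "J \<in> cells \<Longrightarrow> j \<in> J \<Longrightarrow> n j \<bullet> foot J y = b j"
  by (simp add: foot_def inner_add_right inner_residual_eq_0 dual_cells inner_base)

lemma foot_diff: "y - foot J y = (\<Sum>j\<in>J. crd J j y *\<^sub>R n j)"
  by (simp add: foot_def crd_def residual_def)

lemma foot_decomp: "y = foot J y + (\<Sum>j\<in>J. crd J j y *\<^sub>R n j)"
  using residual_decomp[of "y - base J" n J] by (simp add: foot_def crd_def algebra_simps)

lemma crd_add: "crd J i (y + v) = crd J i y + coord_lin n J i v"
proof -
  have "residual n J (y + v - base J) = residual n J (y - base J) + residual n J v"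
    by (metis residual_add add_diff_eq add.commute)
  then show ?thesis
    by (simp add: crd_def coord_lin_def foot_def inner_add_right inner_diff_right)
qed

lemma crd_ray: "crd J i (y + t *\<^sub>R v) = crd J i y + t * coord_lin n J i v"
  by (simp add: crd_add coord_lin_grad)

lemma foot_unique:
  assumes "J \<in> cells" "y = x + (\<Sum>j\<in>J. c j *\<^sub>R n j)" "\<And>j. j \<in> J \<Longrightarrow> n j \<bullet> x = b j"
  shows "foot J y = x" "\<And>j. j \<in> J \<Longrightarrow> crd J j y = c j"
proof -
  have "y - base J = (x - base J) + (\<Sum>j\<in>J. c j *\<^sub>R n j)" using assms by simp
  from residual_unique[OF dual_cells[OF assms(1)] this]
  show "foot J y = x" "\<And>j. j \<in> J \<Longrightarrow> crd J j y = c j"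
    by (simp_all add: foot_def crd_def assms inner_diff_right inner_base)
qed

lemma foot_empty: "foot {} y = y"
  by (simp add: foot_def residual_def)

lemma crd_empty: "crd {} i y = n i \<bullet> y - b i"
  by (simp add: crd_def foot_empty)

lemma foot_in_P:
  assumes "J \<in> cells" "\<forall>i\<in>I. crd J i y \<ge> 0"
  shows "foot J y \<in> P" "J \<subseteq> act (foot J y)"
proof -
  have "b i \<le> n i \<bullet> foot J y" if "i \<in> I" for i
    using assms that inner_foot[OF assms(1), of i y] by (cases "i \<in> J") (auto simp: crd_def)
  then show "foot J y \<in> P" by (simp add: in_P_iff)
  show "J \<subseteq> act (foot J y)"
    using assms cells_subset by (auto simp: act_def inner_foot)
qed

text \<open>Either a term with coefficient zero is dropped from the decomposition of
  \<open>y\<close>, or a facet containing the foot is added with coefficient zero; by uniqueness one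
  decomposition serves both cells.\<close>

lemma crd_toggle:
  assumes J: "J \<in> cells" and nonneg: "\<forall>k\<in>I. crd J k y \<ge> 0" and i: "i \<in> I" "crd J i y = 0"
  shows "toggle i J \<in> cells" "foot (toggle i J) y = foot J y" "\<And>k. crd (toggle i J) k y = crd J k y"
proof -
  note x = foot_in_P[OF J nonneg]
  have i': "n i \<bullet> foot J y = b i"
    using i J inner_foot[of J i y] by (cases "i \<in> J") (auto simp: crd_def)
  have "toggle i J \<subseteq> act (foot J y)"
    using x i i' by (auto simp: toggle_def act_def)
  then show C: "toggle i J \<in> cells" using x by (auto simp: cells_def)
  have fin: "finite J" using J dual_cells dual_family_def by blast
  have "(\<Sum>j\<in>toggle i J. crd J j y *\<^sub>R n j) = (\<Sum>j\<in>J. crd J j y *\<^sub>R n j)"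
    using fin i by (cases "i \<in> J") (simp_all add: toggle_def sum.remove)
  then have "y = foot J y + (\<Sum>j\<in>toggle i J. crd J j y *\<^sub>R n j)"
    using foot_decomp[of y J] by simp
  note unique = foot_unique[OF C this]
  have flat: "n j \<bullet> foot J y = b j" if "j \<in> toggle i J" for j
    using that \<open>toggle i J \<subseteq> act (foot J y)\<close> by (auto simp: act_def)
  note * = unique[OF flat]
  then show "foot (toggle i J) y = foot J y" by simp
  show "crd (toggle i J) k y = crd J k y" for k
  proof (cases "k \<in> toggle i J")
    case False
    have "crd (toggle i J) k y = n k \<bullet> foot J y - b k" using False * by (simp add: crd_def)
    then show ?thesis
      using False i i' by (cases "k = i") (auto simp: crd_def toggle_def split: if_splits)
  qed (use * in simp)
qed

lemma coord_lin_toggle: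
  assumes "J \<in> cells" "toggle i J \<in> cells"
  shows "\<exists>c>0. \<forall>v. coord_lin n J i v = c * coord_lin n (toggle i J) i v"
proof (cases "i \<in> J")
  case True
  then obtain c where c: "c > 0" "\<forall>v. coord_lin n (J - {i}) i v = c * coord_lin n J i v"
    using coord_lin_insert[of n i "J - {i}"] dual_cells[OF assms(1)] by (auto simp: insert_absorb)
  then have "coord_lin n J i v = (1 / c) * coord_lin n (J - {i}) i v" for v by simp
  with c(1) True show ?thesis
    by (intro exI[of _ "1 / c"]) (simp add: toggle_def)
next
  case False
  then show ?thesis
    using coord_lin_insert[of n i J] dual_cells[OF assms(2)] by (auto simp: toggle_def)
qed

text \<open>Thanks to simplicity the coordinates that vanish can be varied one at a time, so their
  gradients are nonzero and pairwise not proportional.\<close>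

lemma vanishing_crds_independent:
  assumes J: "J \<in> cells" and nonneg: "\<forall>k\<in>I. crd J k y \<ge> 0" and i: "i \<in> I" "crd J i y = 0"
  shows "\<exists>w. coord_lin n J i w = 1 \<and> (\<forall>k\<in>I. crd J k y = 0 \<longrightarrow> k \<noteq> i \<longrightarrow> coord_lin n J k w = 0)"
proof (cases "i \<in> J")
  case True
  \<comment> \<open>Moving along \<open>n i\<close> changes multiplier \<open>i\<close> and leaves
    the foot in place.\<close>
  then show ?thesis
    using residual_of_member[OF dual_cells[OF J] True]
    by (intro exI[of _ "n i"]) (auto simp: coord_lin_def)
next
  case False
  note x = foot_in_P[OF J nonneg]
  let ?A = "act (foot J y)"
  have act: "k \<in> ?A" if "k \<in> I" "crd J k y = 0" for k
    using that x by (cases "k \<in> J") (auto simp: crd_def act_def)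
  \<comment> \<open>All facets with vanishing coordinate pass through the foot. The dual vector of
    \<open>?A\<close> leaves facet \<open>i\<close> and stays parallel to the others, in particular
    to those in \<open>J\<close>.\<close>
  have d: "dual_family n ?A" using x by (intro dual_cells act_in_cells)
  then have w: "n k \<bullet> dual_vec n ?A i = of_bool (k = i)" if "k \<in> ?A" for k
    using that i act by (intro dual_vec) auto
  have "n j \<bullet> dual_vec n ?A i = 0" if "j \<in> J" for j
    using that w[of j] x False by auto
  from residual_of_orthogonal[OF dual_cells[OF J] this]
  show ?thesis
    using w act i False by (intro exI[of _ "dual_vec n ?A i"]) (auto simp: coord_lin_def)
qed

text \<open>Two events are to be avoided: a ray running along a wall, and two coordinates of one
  cell vanishing at the same time. Both become finitely many linear conditions on
  \<open>u\<close>.\<close>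

lemma exists_generic_ray:
  assumes "open U" "U \<noteq> {}"
  shows "\<exists>u\<in>U. \<forall>t>0. \<forall>J\<in>cells. (\<forall>k\<in>I. crd J k (V + t *\<^sub>R u) \<ge> 0) \<longrightarrow>
    (\<forall>i\<in>I. crd J i (V + t *\<^sub>R u) = 0 \<longrightarrow>
      coord_lin n J i u \<noteq> 0 \<and> (\<forall>k\<in>I - {i}. crd J k (V + t *\<^sub>R u) \<noteq> 0))"
proof -
  \<comment> \<open>If coordinates \<open>i\<close> and \<open>k\<close> vanish at the same
    \<open>t\<close>, eliminating \<open>t\<close> gives
    \<open>g J i k \<bullet> u = 0\<close>.\<close>
  define g where "g J i k = crd J i V *\<^sub>R coord_grad n J k - crd J k V *\<^sub>R coord_grad n J i" for J i k
  define A where "A = (\<lambda>(J, i). coord_grad n J i) ` (cells \<times> I) \<union> (\<lambda>(J, i, k). g J i k) ` (cells \<times> I \<times> I) - {0}"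
  have "finite A" unfolding A_def using finite_cells finite_I by auto
  then obtain u where u: "u \<in> U" "\<forall>a\<in>A. a \<bullet> u \<noteq> 0"
    using exists_generic_vector[of A U] assms unfolding A_def by auto
  have u1: "coord_grad n J i \<bullet> u \<noteq> 0" if "J \<in> cells" "i \<in> I" "coord_grad n J i \<noteq> 0" for J i
    using that u(2) unfolding A_def by force
  have u2: "g J i k \<bullet> u \<noteq> 0" if "J \<in> cells" "i \<in> I" "k \<in> I" "g J i k \<noteq> 0" for J i k
    using that u(2) unfolding A_def by force
  show ?thesis
  proof (intro bexI[OF _ u(1)] allI ballI impI conjI)
    fix t J i
    assume t: "0 < t" and J: "J \<in> cells" and nonneg: "\<forall>k\<in>I. crd J k (V + t *\<^sub>R u) \<ge> 0"
      and i: "i \<in> I" "crd J i (V + t *\<^sub>R u) = 0"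
    obtain w where w: "coord_lin n J i w = 1"
      "\<forall>k\<in>I. crd J k (V + t *\<^sub>R u) = 0 \<longrightarrow> k \<noteq> i \<longrightarrow> coord_lin n J k w = 0"
      using vanishing_crds_independent[OF J nonneg i] by blast
    have "coord_grad n J i \<noteq> 0" using w(1) by (auto simp: coord_lin_grad)
    then show lin: "coord_lin n J i u \<noteq> 0" using u1 J i by (simp add: coord_lin_grad)
    fix k assume k: "k \<in> I - {i}"
    show "crd J k (V + t *\<^sub>R u) \<noteq> 0"
    proof
      assume k0: "crd J k (V + t *\<^sub>R u) = 0"
      have eqs: "crd J i V = - t * (coord_grad n J i \<bullet> u)" "crd J k V = - t * (coord_grad n J k \<bullet> u)"
        using i k0 by (auto simp: crd_ray coord_lin_grad)
      then have "g J i k \<bullet> u = 0" by (simp add: g_def inner_diff_left)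
      \<comment> \<open>In this degenerate case the variation \<open>w\<close> forces
        \<open>crd J k V = 0\<close>, so the ray would run along wall \<open>k\<close>, which was
        excluded separately.\<close>
      then have "g J i k = 0" using u2 J i k by auto
      then have "crd J i V *\<^sub>R coord_grad n J k = crd J k V *\<^sub>R coord_grad n J i" by (simp add: g_def)
      then have "crd J i V * (coord_grad n J k \<bullet> v) = crd J k V * (coord_grad n J i \<bullet> v)" for v
        by (metis inner_scaleR_left)
      moreover have "coord_grad n J k \<bullet> w = 0" "coord_grad n J i \<bullet> w = 1"
        using w k k0 by (auto simp: coord_lin_grad)
      ultimately have "crd J k V = 0" by (metis mult.right_neutral mult_zero_right)
      then have "coord_grad n J k \<bullet> u = 0" using eqs t by auto
      moreover obtain w' where "coord_lin n J k w' = 1"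
        using vanishing_crds_independent[OF J nonneg _ k0] k by blast
      then have "coord_grad n J k \<noteq> 0" by (auto simp: coord_lin_grad)
      ultimately show False using u1 J k by auto
    qed
  qed
qed

end

section \<open>Affine functions on a ray: initial sign and first exit time\<close>

text \<open>An affine function has a constant sign immediately to the right of 0, so arbitrarily
  small witnesses suffice.\<close>

lemma affine_frequently_pos:
  fixes \<alpha> \<beta> :: real
  assumes "frequently (\<lambda>t. \<alpha> + t * \<beta> > 0) (at_right 0)"
  shows "eventually (\<lambda>t. \<alpha> + t * \<beta> > 0) (at_right 0)"
proof -
  have tend: "((\<lambda>t. \<alpha> + t * \<beta>) \<longlongrightarrow> \<alpha> + 0 * \<beta>) (at_right 0)" by (intro tendsto_intros)
  consider "\<alpha> > 0" | "\<alpha> < 0" | "\<alpha> = 0" "\<beta> > 0" | "\<alpha> = 0" "\<beta> \<le> 0" by linarith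
  then show ?thesis
  proof cases
    case 1
    then show ?thesis using order_tendstoD(1)[OF tend, of 0] by simp
  next
    case 2
    then have "eventually (\<lambda>t. \<alpha> + t * \<beta> < 0) (at_right 0)"
      using order_tendstoD(2)[OF tend, of 0] by simp
    then have "eventually (\<lambda>t. \<not> \<alpha> + t * \<beta> > 0) (at_right 0)" by eventually_elim simp
    with assms show ?thesis by (simp add: frequently_def)
  next
    case 3
    then show ?thesis by (auto simp: eventually_at_right_field intro: exI[of _ 1])
  next
    case 4
    have "eventually (\<lambda>t::real. t > 0) (at_right 0)" by (simp add: eventually_at_right_less)
    then have "eventually (\<lambda>t. \<not> \<alpha> + t * \<beta> > 0) (at_right 0)"
      by eventually_elim (use 4 in \<open>simp add: mult_nonneg_nonpos not_less\<close>)
    with assms show ?thesis by (simp add: frequently_def)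
  qed
qed

text \<open>Only functions with negative slope can reach 0, and \<open>T\<close> is the least of
  their zeros; the negative value assumed guarantees that there is one.\<close>

lemma first_exit_time:
  fixes \<alpha> \<beta> :: "'j \<Rightarrow> real"
  assumes "finite A" and pos: "\<And>j. j \<in> A \<Longrightarrow> eventually (\<lambda>t. \<alpha> j + t * \<beta> j > 0) (at_right 0)"
    and neg: "t > 0" "j \<in> A" "\<alpha> j + t * \<beta> j < 0"
  shows "\<exists>T>0. (\<exists>j\<in>A. \<alpha> j + T * \<beta> j = 0) \<and>
    (\<forall>k\<in>A. \<alpha> k + T * \<beta> k \<ge> 0 \<and> (\<forall>t\<in>{0<..<T}. \<alpha> k + t * \<beta> k > 0))"
proof -
  have start: "\<exists>e>0. \<forall>t. 0 < t \<longrightarrow> t < e \<longrightarrow> \<alpha> k + t * \<beta> k > 0" if "k \<in> A" for k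
    using pos[OF that] by (auto simp: eventually_at_right_field)
  have nonneg: "\<alpha> k \<ge> 0" if "k \<in> A" for k
  proof (rule ccontr)
    assume "\<not> \<alpha> k \<ge> 0"
    moreover have "((\<lambda>t. \<alpha> k + t * \<beta> k) \<longlongrightarrow> \<alpha> k + 0 * \<beta> k) (at_right 0)" by (intro tendsto_intros)
    ultimately have "eventually (\<lambda>t. \<alpha> k + t * \<beta> k < 0) (at_right 0)"
      using order_tendstoD(2)[of "\<lambda>t. \<alpha> k + t * \<beta> k" _ _ 0] by fastforce
    with pos[OF that] have "eventually (\<lambda>t::real. False) (at_right 0)" by eventually_elim simp
    then show False by (simp add: eventually_False trivial_limit_at_right_real)
  qed
  have up: "\<alpha> k + t * \<beta> k > 0" if "k \<in> A" "\<beta> k \<ge> 0" "t > 0" for k t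
  proof (cases "\<beta> k = 0")
    case True
    obtain e where "e > 0" "\<forall>t. 0 < t \<longrightarrow> t < e \<longrightarrow> \<alpha> k + t * \<beta> k > 0" using start[OF \<open>k \<in> A\<close>] by blast
    then have "\<alpha> k + e / 2 * \<beta> k > 0" by (metis field_sum_of_halves half_gt_zero less_add_same_cancel1)
    then show ?thesis using True by simp
  next
    case False
    then have "t * \<beta> k > 0" using that by simp
    then show ?thesis using nonneg[OF \<open>k \<in> A\<close>] by linarith
  qed
  have down: "\<alpha> k > 0" if "k \<in> A" "\<beta> k < 0" for k
  proof -
    obtain e where e: "e > 0" "\<forall>t. 0 < t \<longrightarrow> t < e \<longrightarrow> \<alpha> k + t * \<beta> k > 0" using start[OF \<open>k \<in> A\<close>] by blast
    then have "\<alpha> k + e / 2 * \<beta> k > 0" by (metis field_sum_of_halves half_gt_zero less_add_same_cancel1)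
    moreover have "e / 2 * \<beta> k < 0" using that e by (simp add: mult_pos_neg)
    ultimately show ?thesis by linarith
  qed
  define B where "B = {k\<in>A. \<beta> k < 0}"
  have "j \<in> B" using up[of j t] neg by (force simp: B_def)
  moreover have "finite B" using assms by (simp add: B_def)
  ultimately have M: "Min ((\<lambda>k. - \<alpha> k / \<beta> k) ` B) \<in> (\<lambda>k. - \<alpha> k / \<beta> k) ` B"
    and le: "\<And>k. k \<in> B \<Longrightarrow> Min ((\<lambda>k. - \<alpha> k / \<beta> k) ` B) \<le> - \<alpha> k / \<beta> k"
    by (blast intro: Min_in Min_le)+
  define T where "T = Min ((\<lambda>k. - \<alpha> k / \<beta> k) ` B)"
  obtain i where i: "i \<in> B" "T = - \<alpha> i / \<beta> i" using M by (auto simp: T_def)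
  have T: "T > 0" using i down[of i] by (simp add: B_def divide_pos_neg)
  show ?thesis
  proof (intro exI[of _ T] conjI ballI T)
    show "\<exists>i\<in>A. \<alpha> i + T * \<beta> i = 0" using i by (intro bexI[of _ i]) (auto simp: B_def)
    have *: "T * \<beta> k \<ge> - \<alpha> k" if "k \<in> B" for k
      using le[OF that] that neg_le_divide_eq[of "\<beta> k" T "- \<alpha> k"] by (simp add: T_def B_def)
    show "\<alpha> k + t * \<beta> k > 0" if "k \<in> A" "t \<in> {0<..<T}" for k t
    proof (cases "\<beta> k < 0")
      case True
      then have "t * \<beta> k > T * \<beta> k" using that by simp
      moreover have "T * \<beta> k \<ge> - \<alpha> k" using * True that by (simp add: B_def)
      ultimately show ?thesis by linarith
    qed (use up that in auto)
    show "\<alpha> k + T * \<beta> k \<ge> 0" if "k \<in> A" for k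
      using *[of k] up[of k T] T that by (cases "\<beta> k < 0") (auto simp: B_def)
  qed
qed

context simple_system begin

lemma compact_P: "compact P"
proof -
  have "P = (\<Inter>i\<in>I. {x. n i \<bullet> x \<ge> b i})" by (auto simp: P_eq)
  then have "closed P" by (auto intro: closed_INT closed_halfspace_ge)
  then show ?thesis using bounded_P compact_eq_bounded_closed by blast
qed

text \<open>A feasible step from a farthest point does not increase the distance; the quadratic term
  then makes every feasible direction strictly acute to \<open>y - x\<close>. Two opposite
  directions cannot both be, so \<open>x\<close> is a vertex.\<close>

lemma farthest_point_active:
  assumes x: "x \<in> P" and far: "\<And>p. p \<in> P \<Longrightarrow> dist y p \<le> dist y x"
  shows "\<And>v. (\<And>i. i \<in> act x \<Longrightarrow> n i \<bullet> v = 0) \<Longrightarrow> v = 0" "foot (act x) y = x" "\<And>i. i \<in> I \<Longrightarrow> crd (act x) i y > 0"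
proof -
  have dir: "w \<bullet> (y - x) > 0" if w: "\<And>i. i \<in> act x \<Longrightarrow> n i \<bullet> w \<ge> 0" "w \<noteq> 0" for w
  proof -
    obtain e where e: "e > 0" "x + e *\<^sub>R w \<in> P" using feasible_direction[OF x w(1)] by blast
    then have "norm (y - x - e *\<^sub>R w) \<le> norm (y - x)" using far by (simp add: dist_norm diff_diff_eq)
    then have "(y - x - e *\<^sub>R w) \<bullet> (y - x - e *\<^sub>R w) \<le> (y - x) \<bullet> (y - x)" by (simp add: norm_le)
    then have "e * (e * (w \<bullet> w)) \<le> e * (2 * (w \<bullet> (y - x)))"
      by (simp add: inner_diff_left inner_diff_right inner_commute algebra_simps)
    then have "e * (w \<bullet> w) \<le> 2 * (w \<bullet> (y - x))" using e by simp
    moreover have "e * (w \<bullet> w) > 0" using e w by simp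
    ultimately show ?thesis by linarith
  qed
  show vertex: "v = 0" if "\<And>i. i \<in> act x \<Longrightarrow> n i \<bullet> v = 0" for v
    using dir[of v] dir[of "- v"] that by force
  note C = act_in_cells[OF x]
  note d = dual_cells[OF C]
  have "residual n (act x) (y - x) = 0" by (rule vertex) (simp add: inner_residual_eq_0 d)
  then have "y = x + (\<Sum>j\<in>act x. (dual_vec n (act x) j \<bullet> (y - x)) *\<^sub>R n j)"
    using residual_decomp[of "y - x" n "act x"] by (simp add: algebra_simps)
  note unique = foot_unique[OF C this]
  show "foot (act x) y = x" by (rule unique) (simp add: act_def)
  show "crd (act x) i y > 0" if i: "i \<in> I" for i
  proof (cases "i \<in> act x")
    case True
    \<comment> \<open>The dual vectors are the edge directions at \<open>x\<close>: each leaves one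
      facet and stays in the others, so it is feasible.\<close>
    have "dual_vec n (act x) i \<noteq> 0" using dual_vec(2)[OF d True True] by auto
    moreover have "n k \<bullet> dual_vec n (act x) i \<ge> 0" if "k \<in> act x" for k
      using dual_vec(2)[OF d True that] by simp
    ultimately have "dual_vec n (act x) i \<bullet> (y - x) > 0" by (rule dir[rotated])
    moreover have "crd (act x) i y = dual_vec n (act x) i \<bullet> (y - x)"
      by (rule unique) (use True in \<open>auto simp: act_def\<close>)
    ultimately show ?thesis by simp
  next
    case False
    have "crd (act x) i y = n i \<bullet> x - b i"
      using False \<open>foot (act x) y = x\<close> by (simp add: crd_def)
    then show ?thesis using False i x by (force simp: act_def in_P_iff order_less_le)
  qed
qed

end

section \<open>Parity along a generic ray from a vertex\<close>

text \<open>By \<open>good\<close> a short initial piece of the ray is inside the active regions of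
  all faces through \<open>V\<close>; by \<open>generic\<close> each cell meets its walls
  transversally and one at a time.\<close>

locale generic_ray = simple_system I n b P
  for I :: "'i set" and n :: "'i \<Rightarrow> 'a::euclidean_space" and b P +
  fixes V u :: 'a
  assumes V_in_P: "V \<in> P"
    and vertex_V: "\<And>v. (\<And>i. i \<in> act V \<Longrightarrow> n i \<bullet> v = 0) \<Longrightarrow> v = 0"
    and good: "\<And>J i. J \<subseteq> act V \<Longrightarrow> i \<in> act V \<Longrightarrow> coord_lin n J i u > 0"
    and generic: "\<And>t J i. \<lbrakk>0 < t; J \<in> cells; \<forall>k\<in>I. crd J k (V + t *\<^sub>R u) \<ge> 0; i \<in> I;
        crd J i (V + t *\<^sub>R u) = 0\<rbrakk> \<Longrightarrow>
        coord_lin n J i u \<noteq> 0 \<and> (\<forall>k\<in>I - {i}. crd J k (V + t *\<^sub>R u) \<noteq> 0)"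
begin

definition active :: "real \<Rightarrow> 'i set set" where
  "active t = {J\<in>cells. \<forall>i\<in>I. crd J i (V + t *\<^sub>R u) > 0}"

lemma local_in_cells: "J \<subseteq> act V \<Longrightarrow> J \<in> cells"
  using V_in_P by (auto simp: cells_def)

lemma foot_local: "J \<subseteq> act V \<Longrightarrow> foot J V = V"
  by (rule foot_unique[where c = "\<lambda>_. 0"]) (auto simp: local_in_cells act_def)

lemma crd_local: "J \<subseteq> act V \<Longrightarrow> crd J i V = (if i \<in> J then 0 else n i \<bullet> V - b i)"
  using foot_unique(2)[of J V V "\<lambda>_. 0"] by (auto simp: local_in_cells act_def crd_def foot_local subset_iff)

lemma crd_local_act: "J \<subseteq> act V \<Longrightarrow> i \<in> act V \<Longrightarrow> crd J i V = 0"
  by (auto simp: crd_local act_def)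

lemma foot_vertex: "foot (act V) y = V"
proof -
  note d = dual_cells[OF local_in_cells[OF order_refl]]
  have "foot (act V) y - V = 0"
    by (rule vertex_V) (simp add: inner_diff_right inner_foot local_in_cells act_def)
  then show ?thesis by simp
qed

lemma slack_V: "i \<in> I \<Longrightarrow> i \<notin> act V \<Longrightarrow> n i \<bullet> V - b i > 0"
  using V_in_P by (force simp: act_def in_P_iff order_less_le)

lemma vertex_cell_active: "t > 0 \<Longrightarrow> act V \<in> active t"
  unfolding active_def
proof (intro CollectI conjI ballI)
  fix i assume t: "t > 0" and i: "i \<in> I"
  show "crd (act V) i (V + t *\<^sub>R u) > 0"
  proof (cases "i \<in> act V")
    case True
    then show ?thesis using t good[of "act V" i] by (simp add: crd_ray crd_local_act)
  next
    case False
    then show ?thesis using slack_V[OF i] by (simp add: crd_def foot_vertex)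
  qed
qed (simp add: local_in_cells)

text \<open>As a positive combination of the normals at \<open>V\<close>, \<open>u\<close> grows on
  \<open>P\<close> at least linearly with the distance from \<open>V\<close>. A foot
  \<open>x\<close> of an active cell has \<open>V - x\<close> and \<open>y - x\<close> at
  nonnegative product, which for large \<open>T\<close> leaves only \<open>x = V\<close>.\<close>

lemma active_far: "\<exists>T>0. active T = {act V}"
proof -
  let ?A = "act V" let ?d = "dual_vec n (act V)"
  note C = local_in_cells[OF order_refl]
  note d = dual_cells[OF C]
  have finA: "finite ?A" using d by (simp add: dual_family_def)
  have expand: "v = (\<Sum>i\<in>?A. (n i \<bullet> v) *\<^sub>R ?d i)" for v
  proof -
    have "v - (\<Sum>i\<in>?A. (n i \<bullet> v) *\<^sub>R ?d i) = 0"
    proof (rule vertex_V)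
      fix k assume k: "k \<in> ?A"
      have "n k \<bullet> (\<Sum>i\<in>?A. (n i \<bullet> v) *\<^sub>R ?d i) = (\<Sum>i\<in>?A. if i = k then n k \<bullet> v else 0)"
        unfolding inner_sum_right by (rule sum.cong) (auto simp: dual_vec[OF d] k)
      also have "\<dots> = n k \<bullet> v" using k finA by simp
      finally show "n k \<bullet> (v - (\<Sum>i\<in>?A. (n i \<bullet> v) *\<^sub>R ?d i)) = 0"
        by (simp add: inner_diff_right)
    qed
    then show ?thesis by simp
  qed
  have res: "residual n ?A u = 0" by (rule vertex_V) (simp add: inner_residual_eq_0 d)
  have u_eq: "u = (\<Sum>i\<in>?A. (?d i \<bullet> u) *\<^sub>R n i)"
    using residual_decomp[of u n ?A] unfolding res by simp
  have m: "?d i \<bullet> u > 0" if "i \<in> ?A" for i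
    using good[of ?A i] that by (simp add: coord_lin_def)
  have "\<exists>\<delta>>0. \<forall>i\<in>?A. \<delta> * norm (?d i) \<le> ?d i \<bullet> u"
  proof -
    have "eventually (\<lambda>\<delta>. \<delta> * norm (?d i) < ?d i \<bullet> u) (at_right 0)" if "i \<in> ?A" for i
    proof -
      have "((\<lambda>\<delta>. \<delta> * norm (?d i)) \<longlongrightarrow> 0 * norm (?d i)) (at_right 0)" by (intro tendsto_intros)
      then show ?thesis using m[OF that] order_tendstoD(2) by fastforce
    qed
    then have "eventually (\<lambda>\<delta>. \<forall>i\<in>?A. \<delta> * norm (?d i) < ?d i \<bullet> u) (at_right 0)"
      using finA by (simp add: eventually_ball_finite)
    moreover have "eventually (\<lambda>e::real. e > 0) (at_right 0)" by (simp add: eventually_at_right_less)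
    ultimately have "eventually (\<lambda>\<delta>. \<delta> > 0 \<and> (\<forall>i\<in>?A. \<delta> * norm (?d i) \<le> ?d i \<bullet> u)) (at_right 0)"
      by eventually_elim auto
    then show ?thesis using eventually_happens' trivial_limit_at_right_real by blast
  qed
  then obtain \<delta> where \<delta>: "\<delta> > 0" "\<And>i. i \<in> ?A \<Longrightarrow> \<delta> * norm (?d i) \<le> ?d i \<bullet> u" by blast
  \<comment> \<open>In the dual vectors \<open>x - V\<close> has the slacks of \<open>x\<close> as
    coefficients, which are nonnegative, so the bound on each dual vector adds up.\<close>
  have lower: "\<delta> * norm (x - V) \<le> u \<bullet> (x - V)" if x: "x \<in> P" for x
  proof -
    have s: "n i \<bullet> (x - V) \<ge> 0" if "i \<in> ?A" for i
      using x that by (auto simp: in_P_iff act_def inner_diff_right)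
    have "norm (x - V) \<le> (\<Sum>i\<in>?A. norm ((n i \<bullet> (x - V)) *\<^sub>R ?d i))"
      by (subst expand) (rule norm_sum)
    then have "\<delta> * norm (x - V) \<le> \<delta> * (\<Sum>i\<in>?A. norm ((n i \<bullet> (x - V)) *\<^sub>R ?d i))"
      using \<delta> by simp
    also have "\<dots> = (\<Sum>i\<in>?A. (\<delta> * norm (?d i)) * (n i \<bullet> (x - V)))"
      unfolding sum_distrib_left using s by (intro sum.cong) auto
    also have "\<dots> \<le> (\<Sum>i\<in>?A. (?d i \<bullet> u) * (n i \<bullet> (x - V)))"
      by (intro sum_mono mult_right_mono \<delta> s)
    also have "\<dots> = u \<bullet> (x - V)"
      by (subst (2) u_eq) (simp add: inner_sum_left)
    finally show ?thesis .
  qed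
  obtain D where D: "\<And>x. x \<in> P \<Longrightarrow> norm (x - V) \<le> D"
    using bounded_P bounded_translation[of P "- V"] unfolding bounded_iff
    by (metis (no_types, lifting) add.commute imageI uminus_add_conv_diff)
  \<comment> \<open>Chosen so that \<open>T * \<delta>\<close> exceeds every distance from
    \<open>V\<close> within \<open>P\<close>.\<close>
  define T where "T = (\<bar>D\<bar> + 1) / \<delta>"
  have "T * \<delta> = \<bar>D\<bar> + 1" using \<delta> by (simp add: T_def)
  then have T: "T > 0" "T * \<delta> > D" using \<delta> by (auto simp: T_def)
  have "J = ?A" if J: "J \<in> active T" for J
  proof (rule ccontr)
    assume "J \<noteq> ?A"
    let ?y = "V + T *\<^sub>R u"
    let ?x = "foot J ?y"
    have J': "J \<in> cells" "\<forall>i\<in>I. crd J i ?y > 0" "\<forall>i\<in>I. crd J i ?y \<ge> 0"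
      using J by (auto simp: active_def less_imp_le)
    note x = foot_in_P[OF J'(1,3)]
    have "?y - ?x = (\<Sum>j\<in>J. crd J j ?y *\<^sub>R n j)"
      by (rule foot_diff)
    then have "(V - ?x) \<bullet> (?y - ?x) = (\<Sum>j\<in>J. crd J j ?y * ((V - ?x) \<bullet> n j))"
      by (simp add: inner_sum_right)
    also have "\<dots> \<ge> 0"
    proof (intro sum_nonneg mult_nonneg_nonneg)
      fix j assume j: "j \<in> J"
      then have "j \<in> I" using J' cells_subset by auto
      then show "crd J j ?y \<ge> 0" "(V - ?x) \<bullet> n j \<ge> 0"
        using j J' V_in_P inner_foot[OF J'(1) j, of ?y]
        by (auto simp: in_P_iff inner_diff_left inner_diff_right inner_commute)
    qed
    finally have "(V - ?x) \<bullet> (?y - ?x) \<ge> 0" .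
    moreover have "(V - ?x) \<bullet> (?y - ?x) = (norm (?x - V))\<^sup>2 - T * (u \<bullet> (?x - V))"
      by (simp add: power2_norm_eq_inner inner_diff_left inner_diff_right inner_add_right inner_commute algebra_simps)
    moreover have "T * (u \<bullet> (?x - V)) \<ge> T * (\<delta> * norm (?x - V))"
      using lower[OF x(1)] T by simp
    ultimately have "T * (\<delta> * norm (?x - V)) \<le> norm (?x - V) * norm (?x - V)"
      by (simp add: power2_eq_square)
    moreover have "T * \<delta> > norm (?x - V)" using T D[OF x(1)] by linarith
    ultimately have xV: "?x = V"
      by (metis (no_types, lifting) eq_iff_diff_eq_0 mult.assoc mult_right_less_imp_less norm_eq_zero
        norm_ge_zero not_less order_less_le mult_strict_right_mono)
    \<comment> \<open>A foot at \<open>V\<close> makes \<open>J\<close> a proper subset of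
      \<open>act V\<close>, and a missing facet has slack 0, not a positive one.\<close>
    with x \<open>J \<noteq> ?A\<close> obtain k where k: "k \<in> ?A" "k \<notin> J" by auto
    then have "crd J k ?y = 0" by (simp add: crd_def xV act_def)
    moreover have "k \<in> I" using k by (simp add: act_def)
    ultimately show False using J' by force
  qed
  then show ?thesis using T vertex_cell_active[OF T(1)] by blast
qed

lemma odd_active:
  assumes "t > 0"
  shows "odd (card (active t))"
proof -
  obtain T where T: "T > 0" "active T = {act V}" using active_far by blast
  have "even (card {J\<in>cells. \<forall>i\<in>I. crd J i V + t * coord_lin n J i u > 0}) =
    even (card {J\<in>cells. \<forall>i\<in>I. crd J i V + T * coord_lin n J i u > 0})"
  proof (rule parity_of_cells_constant[OF finite_cells finite_I _ _ assms T(1)])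
    fix t J i
    assume h: "0 < t" "J \<in> cells" "\<forall>k\<in>I. 0 \<le> crd J k V + t * coord_lin n J k u" "i \<in> I"
      "crd J i V + t * coord_lin n J i u = 0"
    show "coord_lin n J i u \<noteq> 0 \<and> (\<forall>k\<in>I - {i}. crd J k V + t * coord_lin n J k u \<noteq> 0)"
      using generic[of t J i] h by (simp add: crd_ray)
    have tog: "toggle i J \<in> cells" "\<And>k. crd (toggle i J) k (V + t *\<^sub>R u) = crd J k (V + t *\<^sub>R u)"
      using crd_toggle[of J "V + t *\<^sub>R u" i] h by (auto simp: crd_ray)
    obtain c where "c > 0" "coord_lin n J i u = c * coord_lin n (toggle i J) i u"
      using coord_lin_toggle[OF h(2) tog(1)] by blast
    then have "coord_lin n J i u * coord_lin n (toggle i J) i u \<ge> 0" by (simp add: mult.assoc)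
    with tog show "toggle i J \<in> cells \<and> 0 \<le> coord_lin n J i u * coord_lin n (toggle i J) i u \<and>
        (\<forall>k\<in>I. crd (toggle i J) k V + t * coord_lin n (toggle i J) k u = crd J k V + t * coord_lin n J k u)"
      by (simp add: crd_ray)
  qed
  then show ?thesis using T by (simp add: active_def crd_ray)
qed

end

section \<open>A point of the ray in many active regions\<close>

context generic_ray begin

text \<open>Each point of the ray has a farthest vertex, and among finitely many cells one serves
  for arbitrarily small \<open>t\<close>. Continuity makes it farthest from \<open>V\<close>; its
  coordinates, being affine, are positive on an initial interval.\<close>

lemma farthest_cell:
  obtains W where "W \<in> cells" "\<And>y. foot W y = base W" "\<And>v. (\<And>i. i \<in> W \<Longrightarrow> n i \<bullet> v = 0) \<Longrightarrow> v = 0"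
    "\<And>p. p \<in> P \<Longrightarrow> dist V p \<le> dist V (base W)"
    "\<And>i. i \<in> I \<Longrightarrow> eventually (\<lambda>t. crd W i V + t * coord_lin n W i u > 0) (at_right 0)"
proof -
  define Q where "Q J t \<longleftrightarrow> (\<forall>v. (\<forall>i\<in>J. n i \<bullet> v = 0) \<longrightarrow> v = 0) \<and>
    (\<forall>p\<in>P. dist (V + t *\<^sub>R u) p \<le> dist (V + t *\<^sub>R u) (base J)) \<and> (\<forall>i\<in>I. crd J i (V + t *\<^sub>R u) > 0)"
    for J t
  have foot_const: "foot J y = base J" if "J \<in> cells" "\<forall>v. (\<forall>i\<in>J. n i \<bullet> v = 0) \<longrightarrow> v = 0" for J y
  proof -
    have "\<forall>i\<in>J. n i \<bullet> (foot J y - base J) = 0" using that by (simp add: inner_diff_right inner_foot inner_base)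
    then show ?thesis using that by auto
  qed
  have "\<exists>J\<in>cells. Q J t" for t
  proof -
    let ?y = "V + t *\<^sub>R u"
    obtain x where x: "x \<in> P" "\<And>p. p \<in> P \<Longrightarrow> dist ?y p \<le> dist ?y x"
      using distance_attains_sup[OF compact_P, of ?y] V_in_P by blast
    note far = farthest_point_active[OF x]
    have "base (act x) = x" using foot_const[OF act_in_cells[OF x(1)], of ?y] far by auto
    then have "Q (act x) t" using far x by (auto simp: Q_def)
    then show ?thesis using act_in_cells[OF x(1)] by blast
  qed
  then have "frequently (\<lambda>t. \<exists>J\<in>cells. Q J t) (at_right 0)"
    by (intro eventually_frequently) (auto simp: trivial_limit_at_right_real)
  then obtain W where W: "W \<in> cells" "frequently (Q W) (at_right 0)"
    using frequently_bex_finite[OF finite_cells, of "\<lambda>t J. Q J t"] by blast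
  then have vertex: "\<forall>v. (\<forall>i\<in>W. n i \<bullet> v = 0) \<longrightarrow> v = 0" by (auto simp: Q_def dest: frequently_ex)
  show thesis
  proof
    show "W \<in> cells" by fact
    show "foot W y = base W" for y using foot_const W vertex by blast
    show "v = 0" if "\<And>i. i \<in> W \<Longrightarrow> n i \<bullet> v = 0" for v using vertex that by blast
    show "dist V p \<le> dist V (base W)" if p: "p \<in> P" for p
    proof (rule ccontr)
      assume "\<not> ?thesis"
      moreover have "((\<lambda>t. dist (V + t *\<^sub>R u) p - dist (V + t *\<^sub>R u) (base W)) \<longlongrightarrow>
          dist (V + 0 *\<^sub>R u) p - dist (V + 0 *\<^sub>R u) (base W)) (at_right 0)"
        by (intro tendsto_intros)
      ultimately have "eventually (\<lambda>t. dist (V + t *\<^sub>R u) p - dist (V + t *\<^sub>R u) (base W) > 0) (at_right 0)"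
        by (intro order_tendstoD) auto
      then have "eventually (\<lambda>t. \<not> Q W t) (at_right 0)"
        by eventually_elim (use p in \<open>force simp: Q_def\<close>)
      then show False using W by (simp add: frequently_def)
    qed
    show "eventually (\<lambda>t. crd W i V + t * coord_lin n W i u > 0) (at_right 0)" if "i \<in> I" for i
      using W(2) by (intro affine_frequently_pos) (auto elim!: frequently_elim1 simp: Q_def crd_ray that)
  qed
qed

lemma local_active_eventually:
  assumes "J \<subseteq> act V" "i \<in> I"
  shows "eventually (\<lambda>t. crd J i V + t * coord_lin n J i u > 0) (at_right 0)"
proof (cases "i \<in> act V")
  case True
  have "eventually (\<lambda>t::real. t > 0) (at_right 0)" by (simp add: eventually_at_right_less)
  then show ?thesis
    by eventually_elim (use assms True good in \<open>simp add: crd_local_act\<close>)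
next
  case False
  then have "crd J i V + 0 * coord_lin n J i u > 0" using assms slack_V by (auto simp: crd_local)
  moreover have "((\<lambda>t. crd J i V + t * coord_lin n J i u) \<longlongrightarrow> crd J i V + 0 * coord_lin n J i u) (at_right 0)"
    by (intro tendsto_intros)
  ultimately show ?thesis by (simp add: order_tendstoD)
qed

lemma act_V_nonempty: "act V \<noteq> {}"
proof
  assume "act V = {}"
  then have "v = 0" for v :: 'a using vertex_V by blast
  then show False using nonempty_Basis nonzero_Basis by blast
qed

lemma u_nonzero: "u \<noteq> 0"
  using act_V_nonempty good[of "{}"] by (auto simp: coord_lin_def residual_def)

lemma ray_leaves_P: "\<exists>t>0. \<exists>i\<in>I. crd {} i V + t * coord_lin n {} i u < 0"
proof (rule ccontr)
  assume "\<not> ?thesis"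
  then have "\<forall>i\<in>I. crd {} i (V + t *\<^sub>R u) \<ge> 0" if "t > 0" for t
    using that by (force simp: crd_ray not_less)
  then have in_P: "V + t *\<^sub>R u \<in> P" if "t > 0" for t
    using that by (simp add: in_P_iff crd_empty)
  obtain D where D: "\<And>x. x \<in> P \<Longrightarrow> norm x \<le> D" using bounded_P bounded_iff by blast
  define t where "t = (D + norm V + 1) / norm u"
  have "D \<ge> 0" using D[OF V_in_P] norm_ge_zero order_trans by blast
  then have t: "t > 0" "t * norm u = D + norm V + 1"
    using u_nonzero by (auto simp: t_def add_nonneg_pos)
  have "t * norm u = norm ((V + t *\<^sub>R u) - V)" using t by simp
  also have "\<dots> \<le> norm (V + t *\<^sub>R u) + norm V" by (rule norm_triangle_ineq4)
  also have "\<dots> \<le> D + norm V" using D[OF in_P[OF t(1)]] by simp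
  finally show False using t by simp
qed

text \<open>Follow the ray until the first of the faces through \<open>V\<close>, or of a vertex \<open>W\<close> farthest from \<open>V\<close>,
  is about to become inactive. It dies together with a further face, since an edge \<open>VW\<close> cannot cancel
  against \<open>W\<close> as long as the ray stays in the ball around \<open>V\<close> through \<open>W\<close>.\<close>

theorem many_active:
  assumes dim: "2 \<le> DIM('a)"
  shows "\<exists>t>0. {} \<in> active t \<and> card (active t - {{}}) \<ge> 2 ^ card (act V) + 2"
proof -
  obtain W where W: "W \<in> cells" "\<And>y. foot W y = base W"
    "\<And>v. (\<And>i. i \<in> W \<Longrightarrow> n i \<bullet> v = 0) \<Longrightarrow> v = 0"
    "\<And>p. p \<in> P \<Longrightarrow> dist V p \<le> dist V (base W)"
    "\<And>i. i \<in> I \<Longrightarrow> eventually (\<lambda>t. crd W i V + t * coord_lin n W i u > 0) (at_right 0)"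
    using farthest_cell by blast
  \<comment> \<open>With three facets at \<open>V\<close> these are the eight faces through
    \<open>V\<close>, \<open>P\<close> included, and the far vertex.\<close>
  define S where "S = insert W (Pow (act V))"
  have finA: "finite (act V)" using finite_I by (simp add: act_def)
  have finS: "finite S" using finA by (simp add: S_def)
  have S: "J \<in> cells" if "J \<in> S" for J using that W local_in_cells by (auto simp: S_def)
  have start: "eventually (\<lambda>t. crd (fst p) (snd p) V + t * coord_lin n (fst p) (snd p) u > 0) (at_right 0)"
    if "p \<in> S \<times> I" for p
    using that W(5) local_active_eventually by (auto simp: S_def)
  obtain t0 i0 where "t0 > 0" "i0 \<in> I" "crd {} i0 V + t0 * coord_lin n {} i0 u < 0"
    using ray_leaves_P by blast
  then have neg: "t0 > 0" "({}, i0) \<in> S \<times> I"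
    "crd (fst ({}, i0)) (snd ({}, i0)) V + t0 * coord_lin n (fst ({}, i0)) (snd ({}, i0)) u < 0"
    by (auto simp: S_def)
  have "finite (S \<times> I)" using finS finite_I by simp
  note exit = first_exit_time[where \<alpha> = "\<lambda>p. crd (fst p) (snd p) V" and
      \<beta> = "\<lambda>p. coord_lin n (fst p) (snd p) u", OF this start neg]
  obtain T where T: "T > 0" and
    die: "\<exists>p\<in>S \<times> I. crd (fst p) (snd p) V + T * coord_lin n (fst p) (snd p) u = 0" and
    alive: "\<forall>q\<in>S \<times> I. crd (fst q) (snd q) V + T * coord_lin n (fst q) (snd q) u \<ge> 0 \<and>
      (\<forall>t\<in>{0<..<T}. crd (fst q) (snd q) V + t * coord_lin n (fst q) (snd q) u > 0)"
    using exit by blast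
  have before: "crd K k (V + t *\<^sub>R u) > 0" if "K \<in> S" "k \<in> I" "0 < t" "t < T" for K k t
    using bspec[OF alive, of "(K, k)"] that by (simp add: crd_ray)
  obtain J i where J: "J \<in> S" "i \<in> I" "crd J i V + T * coord_lin n J i u = 0"
    using die by auto
  let ?y = "V + T *\<^sub>R u"
  have nonneg: "\<forall>k\<in>I. crd K k ?y \<ge> 0" if "K \<in> S" for K
    using alive that by (auto simp: crd_ray)
  have Ji: "crd J i ?y = 0" using J by (simp add: crd_ray)
  note tog = crd_toggle[OF S[OF J(1)] nonneg[OF J(1)] J(2) Ji]
  note gen = generic[OF T S[OF J(1)] nonneg[OF J(1)] J(2) Ji]
  have y_P: "?y \<in> P" using nonneg[of "{}"] by (simp add: S_def in_P_iff crd_empty)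
  have W_nonlocal: "base W \<noteq> V"
  proof
    assume "base W = V"
    then have single: "p = V" if "p \<in> P" for p using W(4)[OF that] by simp
    have "\<forall>k\<in>I. crd {} k (V + (T / 2) *\<^sub>R u) > 0"
      using before[of "{}" _ "T / 2"] T by (simp add: S_def)
    then have "V + (T / 2) *\<^sub>R u \<in> P" by (auto simp: in_P_iff crd_empty less_imp_le)
    then show False using single T u_nonzero by fastforce
  qed
  \<comment> \<open>With its foot at \<open>W\<close>, a face through \<open>V\<close> contains both
    \<open>V\<close> and \<open>W\<close>, and \<open>?y - base W\<close> is normal to it.
    Pythagoras and the choice of \<open>W\<close> then force \<open>?y = base W\<close>.\<close>
  have no_swap: False if K: "K \<subseteq> act V" "foot K ?y = base W" for K
  proof -
    have "?y - base W = (\<Sum>j\<in>K. crd K j ?y *\<^sub>R n j)"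
      using foot_diff[of ?y K] K by simp
    moreover have "n j \<bullet> (V - base W) = 0" if "j \<in> K" for j
      using that K inner_foot[OF local_in_cells[OF K(1)] that, of ?y] by (auto simp: act_def inner_diff_right)
    ultimately have "orthogonal (?y - base W) (V - base W)"
      by (simp add: orthogonal_def inner_sum_left)
    moreover have "(norm (a - c))\<^sup>2 = (norm a)\<^sup>2 + (norm c)\<^sup>2" if "orthogonal a c" for a c :: 'a
      using norm_add_Pythagorean[of a "- c"] that by (simp add: orthogonal_clauses)
    ultimately have "(norm ((?y - base W) - (V - base W)))\<^sup>2 = (norm (?y - base W))\<^sup>2 + (norm (V - base W))\<^sup>2"
      by blast
    moreover have "(?y - base W) - (V - base W) = ?y - V" by simp
    ultimately have "(norm (?y - V))\<^sup>2 = (norm (?y - base W))\<^sup>2 + (norm (V - base W))\<^sup>2"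
      by (simp only:)
    moreover have "(norm (?y - V))\<^sup>2 \<le> (norm (V - base W))\<^sup>2"
      using W(4)[OF y_P] by (intro power_mono) (auto simp: dist_norm norm_minus_commute)
    ultimately have "?y = base W" by simp
    then have zero: "crd {} k ?y = 0" if "k \<in> W" for k
      using that W(1) by (simp add: crd_empty inner_base)
    \<comment> \<open>At \<open>base W\<close> the slacks of all its facets vanish at once.
      Genericity permits one such facet, but a single normal has a nontrivial kernel.\<close>
    have "\<exists>k. W \<subseteq> {k}"
    proof (rule ccontr)
      assume "\<not> ?thesis"
      then obtain k l where kl: "k \<in> W" "l \<in> W" "k \<noteq> l" by blast
      then have "k \<in> I" "l \<in> I" using W(1) cells_subset by auto
      then show False
        using generic[OF T _ nonneg[of "{}"], of k] zero kl local_in_cells[of "{}"] by (auto simp: S_def)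
    qed
    then obtain k where k: "W \<subseteq> {k}" by blast
    obtain v where "v \<noteq> 0" "orthogonal (n k) v" using orthogonal_to_vector_exists[OF dim] by blast
    then show False using W(3)[of v] k by (auto simp: orthogonal_def)
  qed
  have new: "toggle i J \<notin> S"
  proof
    assume "toggle i J \<in> S"
    consider "J \<subseteq> act V" "toggle i J \<subseteq> act V" | "J \<subseteq> act V" "toggle i J = W" | "J = W" "toggle i J \<subseteq> act V"
      | "J = W" "toggle i J = W"
      using J(1) \<open>toggle i J \<in> S\<close> by (auto simp: S_def)
    then show False
    proof cases
      case 1
      \<comment> \<open>For faces through \<open>V\<close> the coordinates in \<open>act V\<close>
        grow linearly from 0, so they do not vanish at \<open>T\<close>.\<close>
      then have "i \<in> act V" by (auto simp: toggle_def split: if_splits)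
      then have "crd J i ?y > 0" using 1 T good[of J i] by (simp add: crd_ray crd_local_act)
      then show False using Ji by simp
    next
      case 2
      then show False using no_swap[of J] tog W(2) by simp
    next
      case 3
      then show False using no_swap[of "toggle i J"] tog W(2) by simp
    next
      case 4
      then show False by (metis mem_toggle)
    qed
  qed
  have W_new: "W \<notin> Pow (act V)"
    using foot_local[of W] W(2)[of V] W_nonlocal by auto
  then have cardS: "card S = 2 ^ card (act V) + 1"
    using finA by (simp add: S_def card_Pow)
  \<comment> \<open>At \<open>T\<close> the partner cell has the same coordinates, zero only at
    \<open>i\<close>, where its slope has the sign of that of \<open>J\<close>; so it too is active
    just before \<open>T\<close>.\<close>
  have "eventually (\<lambda>t. crd (toggle i J) k (V + t *\<^sub>R u) > 0) (at_left T)" if k: "k \<in> I" for k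
  proof (cases "k = i")
    case True
    obtain c where c: "c > 0" "coord_lin n J i u = c * coord_lin n (toggle i J) i u"
      using coord_lin_toggle[OF S[OF J(1)] tog(1)] by blast
    have lin: "crd K i (V + t *\<^sub>R u) = (t - T) * coord_lin n K i u" if "crd K i ?y = 0" for K t
      using that by (simp add: crd_ray algebra_simps)
    have "crd J i (V + (T / 2) *\<^sub>R u) > 0"
      using before[of J i "T / 2"] T J by simp
    then have "coord_lin n J i u < 0" using lin[OF Ji, of "T / 2"] T by (simp add: zero_less_mult_iff mult_less_0_iff)
    then have neg: "coord_lin n (toggle i J) i u < 0" using c by (simp add: mult_less_0_iff)
    have "eventually (\<lambda>t. t < T) (at_left T)" by (simp add: eventually_at_left_field) (use T in auto)
    then show ?thesis
      by eventually_elim (use neg tog(3) Ji in \<open>simp add: True lin mult_neg_neg\<close>)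
  next
    case False
    have "crd (toggle i J) k ?y > 0"
      using tog(3) nonneg[OF J(1)] gen k False by (simp add: order_less_le)
    moreover have "((\<lambda>t. crd (toggle i J) k V + t * coord_lin n (toggle i J) k u) \<longlongrightarrow>
        crd (toggle i J) k V + T * coord_lin n (toggle i J) k u) (at_left T)"
      by (intro tendsto_intros)
    ultimately show ?thesis by (simp add: order_tendstoD crd_ray)
  qed
  then have "eventually (\<lambda>t. \<forall>k\<in>I. crd (toggle i J) k (V + t *\<^sub>R u) > 0) (at_left T)"
    using finite_I by (simp add: eventually_ball_finite)
  moreover have "eventually (\<lambda>t. 0 < t \<and> t < T) (at_left T)"
    unfolding eventually_at_left_field using T by (auto intro: exI[of _ 0])
  ultimately have "eventually (\<lambda>t. 0 < t \<and> t < T \<and> (\<forall>k\<in>I. crd (toggle i J) k (V + t *\<^sub>R u) > 0)) (at_left T)"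
    by eventually_elim auto
  then obtain t where t: "0 < t" "t < T" "\<forall>k\<in>I. crd (toggle i J) k (V + t *\<^sub>R u) > 0"
    using eventually_happens' trivial_limit_at_left_real by blast
  have sub: "insert (toggle i J) S \<subseteq> active t"
    using t tog(1) S before by (auto simp: active_def)
  have fin: "finite (active t)" using finite_cells by (simp add: active_def)
  have "card (insert (toggle i J) S) \<le> card (active t)" by (rule card_mono[OF fin sub])
  then have "card (active t) \<ge> 2 ^ card (act V) + 2" using new finS cardS by simp
  \<comment> \<open>The count is odd and at least an even number, hence at least one more; the
    surplus makes up for discarding the cell of \<open>P\<close>.\<close>
  moreover have "even ((2::nat) ^ card (act V))" using act_V_nonempty finA by (simp add: card_gt_0_iff)
  then have "card (active t) \<noteq> 2 ^ card (act V) + 2" using odd_active[OF t(1)] by auto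
  moreover have empty: "{} \<in> active t" using sub by (auto simp: S_def)
  then have "card (active t - {{}}) = card (active t) - 1" by simp
  ultimately show ?thesis using t(1) empty by (intro exI[of _ t]) simp
qed

end

section \<open>A good direction at a vertex\<close>

text \<open>Strict Cauchy-Schwarz: \<open>m\<close> certifies that \<open>a\<close> is not a
  multiple of \<open>c\<close>, and \<open>?v\<close> is the part of \<open>a\<close> orthogonal to
  \<open>c\<close>, scaled by \<open>c \<bullet> c\<close>.\<close>

lemma gram_strict:
  fixes a c :: "'a::real_inner"
  assumes "m \<bullet> a = 1" "m \<bullet> c = 0" "c \<noteq> 0"
  shows "(a \<bullet> c)\<^sup>2 < (a \<bullet> a) * (c \<bullet> c)"
proof -
  let ?v = "(c \<bullet> c) *\<^sub>R a - (a \<bullet> c) *\<^sub>R c"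
  have c: "c \<bullet> c > 0" using assms by simp
  have "m \<bullet> ?v = c \<bullet> c" using assms by (simp add: inner_diff_right)
  then have "?v \<noteq> 0" using c by force
  then have "?v \<bullet> ?v > 0" by (simp only: inner_gt_zero_iff not_False_eq_True)
  moreover have "?v \<bullet> ?v = (c \<bullet> c) * ((a \<bullet> a) * (c \<bullet> c) - (a \<bullet> c)\<^sup>2)"
    by (simp add: inner_diff_left inner_diff_right inner_commute[of c a] power2_eq_square right_diff_distrib)
  ultimately show ?thesis using c by (simp add: zero_less_mult_iff)
qed

text \<open>A simple vertex: \<open>n\<close> are the inner facet normals, and \<open>w x\<close>
  points along the edge that leaves facet \<open>x\<close>. Thus \<open>w i\<close> and
  \<open>w j\<close> span the planar angle in facet \<open>k\<close>, and the dihedral angle of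
  facets \<open>i\<close> and \<open>j\<close> is obtuse exactly when
  \<open>n i \<bullet> n j > 0\<close>.\<close>

locale vertex_frame =
  fixes n w :: "'i \<Rightarrow> 'a::euclidean_space" and i j k :: 'i
  assumes distinct: "i \<noteq> j" "j \<noteq> k" "i \<noteq> k"
    and dual: "\<And>x y. x \<in> {i, j, k} \<Longrightarrow> y \<in> {i, j, k} \<Longrightarrow> n x \<bullet> w y = of_bool (x = y)"
    and full: "\<And>v. n i \<bullet> v = 0 \<Longrightarrow> n j \<bullet> v = 0 \<Longrightarrow> n k \<bullet> v = 0 \<Longrightarrow> v = 0"
begin

lemma dual_family_frame: "dual_family n {i, j, k}"
  unfolding dual_family_def using dual by (metis finite.emptyI finite.insertI)

lemma expand: "v = (w i \<bullet> v) *\<^sub>R n i + (w j \<bullet> v) *\<^sub>R n j + (w k \<bullet> v) *\<^sub>R n k"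
proof -
  have A: "dual_family n {i, j, k}" by (rule dual_family_frame)
  have "residual n {i, j, k} v = 0"
    by (rule full) (simp_all add: inner_residual_eq_0[OF A])
  then obtain a b c where v: "v = a *\<^sub>R n i + b *\<^sub>R n j + c *\<^sub>R n k"
    using residual_decomp[of v n "{i, j, k}"] distinct by (auto simp: add.assoc)
  have "w x \<bullet> n y = of_bool (x = y)" if "x \<in> {i, j, k}" "y \<in> {i, j, k}" for x y
    using dual[OF that(2,1)] by (auto simp: inner_commute)
  then have "w i \<bullet> v = a" "w j \<bullet> v = b" "w k \<bullet> v = c"
    using distinct by (simp_all add: v inner_add_right)
  with v show ?thesis by simp
qed

lemma w_nonzero: "x \<in> {i, j, k} \<Longrightarrow> w x \<noteq> 0"
  using dual[of x x] by auto

lemma n_nonzero: "x \<in> {i, j, k} \<Longrightarrow> n x \<noteq> 0"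
  using dual[of x x] by auto

text \<open>A cofactor identity expressing that the Gram matrices of \<open>n\<close> and
  \<open>w\<close> are inverse: \<open>n i \<bullet> n k\<close> is eliminated from the relations
  saying that \<open>n i\<close> is orthogonal to \<open>w j\<close> and \<open>w k\<close>.\<close>

lemma gram_inverse:
  "(n i \<bullet> n j) * ((w j \<bullet> w j) * (w k \<bullet> w k) - (w j \<bullet> w k)\<^sup>2) =
   - (n i \<bullet> n i) * ((w i \<bullet> w j) * (w k \<bullet> w k) - (w i \<bullet> w k) * (w j \<bullet> w k))"
proof -
  have row: "(w i \<bullet> w y) * (n i \<bullet> n i) + (w j \<bullet> w y) * (n i \<bullet> n j) + (w k \<bullet> w y) * (n i \<bullet> n k) = n i \<bullet> w y" for y
    by (subst (4) expand[of "w y"]) (simp add: inner_add_right)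
  have "(w i \<bullet> w j) * (n i \<bullet> n i) + (w j \<bullet> w j) * (n i \<bullet> n j) + (w j \<bullet> w k) * (n i \<bullet> n k) = 0"
    "(w i \<bullet> w k) * (n i \<bullet> n i) + (w j \<bullet> w k) * (n i \<bullet> n j) + (w k \<bullet> w k) * (n i \<bullet> n k) = 0"
    using row[of j] row[of k] dual[of i j] dual[of i k] distinct by (simp_all add: inner_commute)
  then show ?thesis by algebra
qed

lemma gram_minor_pos: "(w j \<bullet> w j) * (w k \<bullet> w k) - (w j \<bullet> w k)\<^sup>2 > 0"
  using gram_strict[of "n j" "w j" "w k"] dual[of j j] dual[of j k] distinct w_nonzero[of k] by simp

text \<open>The witness has \<open>n i \<bullet> u\<close> very large, and \<open>n j \<bullet> u\<close>, \<open>n k \<bullet> u\<close> equal to the norms of \<open>n j\<close>, \<open>n k\<close>: it is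
  equidistant from the last two facets, hence projects into both.\<close>

lemma direction_of_obtuse_pair:
  assumes w: "w i \<bullet> w j > 0" "w i \<bullet> w k > 0" and n: "n i \<bullet> n j \<le> 0" "n i \<bullet> n k \<le> 0"
  shows "\<exists>u. \<forall>J x. J \<subseteq> {i, j, k} \<longrightarrow> x \<in> {i, j, k} \<longrightarrow> coord_lin n J x u > 0"
proof -
  have big: "eventually (\<lambda>Q::real. Q * a + b > 0) at_top" if "a > 0" for a b :: real
  proof -
    have "eventually (\<lambda>Q. Q > - b / a) at_top" by (rule eventually_gt_at_top)
    then show ?thesis
    proof eventually_elim
      case (elim Q)
      then have "- b < Q * a" using that by (simp only: pos_divide_less_eq)
      then show ?case by linarith
    qed
  qed
  let ?v = "norm (n j) *\<^sub>R w j + norm (n k) *\<^sub>R w k"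
  \<comment> \<open>All leading coefficients in \<open>Q\<close> are positive, so a large
    \<open>Q\<close> works.\<close>
  have "eventually (\<lambda>Q. Q > 0 \<and> Q * (w i \<bullet> w i) + w i \<bullet> ?v > 0 \<and> Q * (w i \<bullet> w j) + w j \<bullet> ?v > 0 \<and>
      Q * (w i \<bullet> w k) + w k \<bullet> ?v > 0) at_top"
    using w w_nonzero[of i] by (intro eventually_conj big eventually_gt_at_top) auto
  then obtain Q where Q: "Q > 0" "Q * (w i \<bullet> w i) + w i \<bullet> ?v > 0" "Q * (w i \<bullet> w j) + w j \<bullet> ?v > 0"
      "Q * (w i \<bullet> w k) + w k \<bullet> ?v > 0"
    using eventually_happens' trivial_limit_at_top_linorder by blast
  define u where "u = Q *\<^sub>R w i + ?v"
  have nu: "n i \<bullet> u = Q" "n j \<bullet> u = norm (n j)" "n k \<bullet> u = norm (n k)"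
    using dual distinct by (auto simp: u_def inner_add_right)
  have wu: "w x \<bullet> u > 0" if "x \<in> {i, j, k}" for x
    using that Q by (auto simp: u_def inner_add_right inner_commute[of "w j" "w i"] inner_commute[of "w k" "w i"])
  have norms: "norm (n j) > 0" "norm (n k) > 0" using n_nonzero by auto
  have A: "dual_family n {i, j, k}" by (rule dual_family_frame)
  have pos_empty: "coord_lin n {} x u > 0" if "x \<in> {i, j, k}" for x
    using that nu Q norms by (auto simp: coord_lin_def residual_def)
  have pos_full: "coord_lin n {i, j, k} x u > 0" if "x \<in> {i, j, k}" for x
  proof -
    have "u = 0 + (\<Sum>x\<in>{i, j, k}. (w x \<bullet> u) *\<^sub>R n x)"
      using expand[of u] distinct by (simp add: add.assoc)
    then have "dual_vec n {i, j, k} x \<bullet> u = w x \<bullet> u"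
      using that by (intro residual_unique(2)[OF A, where c = "\<lambda>x. w x \<bullet> u"]) auto
    then show ?thesis using that wu by (simp add: coord_lin_def)
  qed
  have single: "coord_lin n {x} y u = n y \<bullet> u - (n x \<bullet> u) * (n x \<bullet> n y) / (n x \<bullet> n x)"
    if "x \<in> {i, j, k}" "y \<noteq> x" for x y
  proof -
    let ?c = "(n x \<bullet> u) / (n x \<bullet> n x)"
    have "dual_family n {x}" using A that by (intro dual_family_subset[OF A]) auto
    then have "residual n {x} u = u - ?c *\<^sub>R n x"
      using n_nonzero[OF that(1)]
      by (intro residual_unique(1)[where c = "\<lambda>_. ?c"]) (auto simp: inner_diff_right)
    then show ?thesis using that by (simp add: coord_lin_def inner_diff_right inner_commute)
  qed
  have cs: "n j \<bullet> n k < norm (n j) * norm (n k)"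
  proof -
    have "(n j \<bullet> n k)\<^sup>2 < (n j \<bullet> n j) * (n k \<bullet> n k)"
      using gram_strict[of "w j" "n j" "n k"] dual[of j j] dual[of k j] distinct n_nonzero[of k]
      by (simp add: inner_commute)
    then have "(n j \<bullet> n k)\<^sup>2 < (norm (n j) * norm (n k))\<^sup>2"
      by (simp add: power_mult_distrib power2_norm_eq_inner)
    then show ?thesis by (rule power2_less_imp_less) simp
  qed
  have pos_single: "coord_lin n {x} y u > 0" if "x \<in> {i, j, k}" "y \<in> {i, j, k}" "x \<noteq> y" for x y
  proof -
    have xx: "n x \<bullet> n x > 0" using n_nonzero that by simp
    have "n y \<bullet> u > (n x \<bullet> u) * (n x \<bullet> n y) / (n x \<bullet> n x)"
    proof (cases "n x \<bullet> n y \<le> 0")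
      case True
      have "n x \<bullet> u > 0" "n y \<bullet> u > 0" using that nu Q norms by auto
      then have "(n x \<bullet> u) * (n x \<bullet> n y) / (n x \<bullet> n x) \<le> 0"
        using True xx by (simp add: divide_nonpos_pos mult_nonneg_nonpos)
      with \<open>n y \<bullet> u > 0\<close> show ?thesis by linarith
    next
      case False
      \<comment> \<open>Only \<open>j\<close> and \<open>k\<close> can have a positive product. As
        \<open>u\<close> is equidistant from these facets, the claim is strict
        Cauchy-Schwarz.\<close>
      then have "(x, y) = (j, k) \<or> (x, y) = (k, j)" using that n distinct by (auto simp: inner_commute)
      then have "n x \<bullet> n y < norm (n x) * norm (n y)" "n x \<bullet> u = norm (n x)" "n y \<bullet> u = norm (n y)"
        using cs nu by (auto simp: inner_commute mult.commute)
      moreover have "n x \<bullet> n x = norm (n x) * norm (n x)" by (simp add: dot_square_norm power2_eq_square)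
      moreover have "norm (n x) > 0" using xx by simp
      ultimately show ?thesis by (simp add: divide_simps mult.commute)
    qed
    then show ?thesis using single that by simp
  qed
  have flip: "coord_lin n J x u > 0 \<longleftrightarrow> coord_lin n (insert x J) x u > 0"
    if "x \<notin> J" "insert x J \<subseteq> {i, j, k}" for x J
  proof -
    have "dual_family n (insert x J)" by (rule dual_family_subset[OF A that(2)])
    then have "\<exists>c>0. \<forall>v. coord_lin n J x v = c * coord_lin n (insert x J) x v"
      by (rule coord_lin_insert) (rule that(1))
    then obtain c where "c > 0" "coord_lin n J x u = c * coord_lin n (insert x J) x u" by blast
    then show ?thesis by (simp add: zero_less_mult_iff)
  qed
  have out: "coord_lin n J x u > 0" if J: "J \<subseteq> {i, j, k}" "x \<in> {i, j, k}" "x \<notin> J" for J x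
  proof -
    \<comment> \<open>Sets with at most one element are done; a set with two is completed by
      \<open>x\<close>, and \<open>flip\<close> passes to the full frame.\<close>
    consider "J = {}" | y where "J = {y}" | "insert x J = {i, j, k}"
    proof -
      obtain y z where yz: "{i, j, k} = {x, y, z}"
        using J(2) by (metis insertE insert_commute singletonD)
      then have "J \<subseteq> {y, z}" using J by auto
      then have "J = {} \<or> J = {y} \<or> J = {z} \<or> J = {y, z}" by blast
      then have "J = {} \<or> J = {y} \<or> J = {z} \<or> insert x J = {i, j, k}" using yz by auto
      then show ?thesis using that by blast
    qed
    then show ?thesis
    proof cases
      case 3
      then show ?thesis using flip[of x J] pos_full[of x] J by simp
    qed (use pos_empty pos_single J in auto)
  qed
  show ?thesis
  proof (intro exI[of _ u] allI impI)
    fix J x assume J: "J \<subseteq> {i, j, k}" "x \<in> {i, j, k}"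
    show "coord_lin n J x u > 0"
    proof (cases "x \<in> J")
      case True
      have "coord_lin n (J - {x}) x u > 0" by (rule out) (use J in auto)
      then show ?thesis using flip[of x "J - {x}"] True J by (auto simp: insert_absorb)
    qed (use out J in auto)
  qed
qed

text \<open>An obtuse dihedral angle turns the cofactor identity into \<open>a * z < b * c\<close>,
  which together with the positive minors fixes the other signs. They are exactly what lets
  \<open>k\<close> take the role of \<open>i\<close> in
  \<open>direction_of_obtuse_pair\<close>.\<close>

lemma sign_pattern:
  assumes w: "w i \<bullet> w j > 0" "w i \<bullet> w k > 0" and n: "n i \<bullet> n j > 0"
  shows "w j \<bullet> w k > 0 \<and> n i \<bullet> n k \<le> 0 \<and> n j \<bullet> n k \<le> 0"
proof -
  interpret ikj: vertex_frame n w i k j using distinct dual full by unfold_locales auto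
  interpret jki: vertex_frame n w j k i using distinct dual full by unfold_locales auto
  define a b c where "a = w i \<bullet> w j" and "b = w i \<bullet> w k" and "c = w j \<bullet> w k"
  define x y z where "x = w i \<bullet> w i" and "y = w j \<bullet> w j" and "z = w k \<bullet> w k"
  note defs = a_def b_def c_def x_def y_def z_def
  have pos: "x > 0" "y > 0" "z > 0" "a > 0" "b > 0" using w w_nonzero by (auto simp: defs)
  have nn: "n i \<bullet> n i > 0" "n j \<bullet> n j > 0" using n_nonzero by auto
  have minors: "y * z - c\<^sup>2 > 0" "z * x - b\<^sup>2 > 0"
    using gram_minor_pos jki.gram_minor_pos by (simp_all add: defs inner_commute)
  have "(n i \<bullet> n j) * (y * z - c\<^sup>2) = - (n i \<bullet> n i) * (a * z - b * c)"
    using gram_inverse by (simp add: defs)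
  moreover have "(n i \<bullet> n j) * (y * z - c\<^sup>2) > 0" using n minors by simp
  ultimately have "(n i \<bullet> n i) * (a * z - b * c) < 0" by simp
  then have az: "a * z < b * c" using nn by (simp add: mult_less_0_iff)
  moreover have "a * z > 0" using pos by simp
  ultimately have "b * c > 0" by linarith
  then have c: "c > 0" using pos by (simp add: zero_less_mult_iff)
  \<comment> \<open>Multiply \<open>a * z < b * c\<close> by \<open>c\<close> (below by
    \<open>b\<close>), bound the square by a positive minor and cancel \<open>z\<close>.\<close>
  have "(a * c) * z \<le> (b * y) * z"
  proof -
    have "(a * c) * z \<le> b * (c * c)" using mult_right_mono[OF less_imp_le[OF az], of c] c by (simp add: mult_ac)
    also have "\<dots> \<le> b * (y * z)" using minors pos by (intro mult_left_mono) (auto simp: power2_eq_square)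
    finally show ?thesis by (simp add: mult_ac)
  qed
  then have ik: "a * c \<le> b * y" using pos by simp
  have "(a * b) * z \<le> (c * x) * z"
  proof -
    have "(a * b) * z \<le> c * (b * b)" using mult_right_mono[OF less_imp_le[OF az], of b] pos by (simp add: mult_ac)
    also have "\<dots> \<le> c * (z * x)" using minors c by (intro mult_left_mono) (auto simp: power2_eq_square)
    finally show ?thesis by (simp add: mult_ac)
  qed
  then have jk: "a * b \<le> c * x" using pos by simp
  have "(n i \<bullet> n k) * (y * z - c\<^sup>2) = - (n i \<bullet> n i) * (b * y - a * c)"
    using ikj.gram_inverse by (simp add: defs inner_commute mult.commute)
  also have "\<dots> \<le> 0" using nn ik by (simp add: mult_nonneg_nonneg)
  finally have "n i \<bullet> n k \<le> 0" using minors by (simp add: mult_le_0_iff)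
  moreover have "(n j \<bullet> n k) * (z * x - b\<^sup>2) = - (n j \<bullet> n j) * (c * x - a * b)"
    using jki.gram_inverse by (simp add: defs inner_commute mult.commute)
  then have "(n j \<bullet> n k) * (z * x - b\<^sup>2) \<le> 0" using nn jk by (simp add: mult_nonneg_nonneg)
  then have "n j \<bullet> n k \<le> 0" using minors by (simp add: mult_le_0_iff)
  ultimately show ?thesis using c by (simp add: defs)
qed

text \<open>If facet \<open>i\<close> makes an obtuse dihedral angle with one of the other two,
  \<open>sign_pattern\<close> gives the distinguished role to the remaining one.\<close>

lemma exists_good_direction:
  assumes w: "w i \<bullet> w j > 0" "w i \<bullet> w k > 0"
  shows "\<exists>u. \<forall>J x. J \<subseteq> {i, j, k} \<longrightarrow> x \<in> {i, j, k} \<longrightarrow> coord_lin n J x u > 0"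
proof -
  interpret ikj: vertex_frame n w i k j using distinct dual full by unfold_locales auto
  interpret kij: vertex_frame n w k i j using distinct dual full by unfold_locales auto
  interpret jik: vertex_frame n w j i k using distinct dual full by unfold_locales auto
  have perm: "{k, i, j} = {i, j, k}" "{j, i, k} = {i, j, k}" by auto
  consider "n i \<bullet> n j \<le> 0" "n i \<bullet> n k \<le> 0" | "n i \<bullet> n j > 0" | "n i \<bullet> n k > 0" by linarith
  then show ?thesis
  proof cases
    case 1
    then show ?thesis using direction_of_obtuse_pair w by blast
  next
    case 2
    then show ?thesis
      using kij.direction_of_obtuse_pair sign_pattern[OF w] w unfolding perm by (simp add: inner_commute)
  next
    case 3
    then show ?thesis
      using jik.direction_of_obtuse_pair ikj.sign_pattern w unfolding perm by (simp add: inner_commute)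
  qed
qed

end

section \<open>From active regions to normals\<close>

definition normal_feet :: "(real^3) set \<Rightarrow> real^3 \<Rightarrow> (real^3) set" where
  "normal_feet P y = {z\<in>P. \<exists>h. support_plane P h \<and> z \<in> h \<and> perp_to_plane y z h}"

lemma normals_from_eq: "normals_from P y = closed_segment y ` normal_feet P y"
  by (auto simp: normals_from_def normal_feet_def)

lemma card_normals_from: "card (normals_from P y) = card (normal_feet P y)"
proof -
  have "inj_on (closed_segment y) A" for A :: "(real^3) set"
    by (intro inj_onI) (metis closed_segment_eq doubleton_eq_iff)
  then show ?thesis unfolding normals_from_eq by (rule card_image)
qed

text \<open>\<open>z - y\<close> is a multiple of the outer normal of the support plane, and a
  nonnegative one because \<open>y\<close> is in \<open>P\<close>.\<close>

lemma normal_foot_inner: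
  assumes y: "y \<in> P" and z: "z \<in> normal_feet P y" and p: "p \<in> P"
  shows "(p - z) \<bullet> (y - z) \<ge> 0"
proof -
  obtain a c where a: "a \<noteq> 0" "P \<subseteq> {x. a \<bullet> x \<le> c}" "a \<bullet> z = c"
    and perp: "perp_to_plane y z {x. a \<bullet> x = c}"
    using z by (auto simp: normal_feet_def support_plane_def)
  let ?d = "z - y"
  define k where "k = (?d \<bullet> a) / (a \<bullet> a)"
  define v where "v = ?d - k *\<^sub>R a"
  have av: "a \<bullet> v = 0" using a by (simp add: v_def k_def inner_diff_right inner_commute)
  \<comment> \<open>\<open>z\<close> and \<open>z + v\<close> both lie in the plane, so
    perpendicularity applies to \<open>v\<close>.\<close>
  then have "?d \<bullet> v = 0"
    using perp a unfolding perp_to_plane_def orthogonal_def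
    by (metis (mono_tags, lifting) add_diff_cancel_left' inner_add_right mem_Collect_eq add.right_neutral)
  then have "v \<bullet> v = 0" using av by (simp add: v_def inner_diff_left)
  then have d: "?d = k *\<^sub>R a" by (simp add: v_def)
  have "a \<bullet> ?d \<ge> 0" using a y by (auto simp: inner_diff_right)
  then have "?d \<bullet> a \<ge> 0" by (simp only: inner_commute)
  then have "k \<ge> 0" by (simp add: k_def)
  moreover have "a \<bullet> (z - p) \<ge> 0" using a p by (auto simp: inner_diff_right)
  moreover have "(p - z) \<bullet> (y - z) = k * (a \<bullet> (z - p))"
  proof -
    have "(p - z) \<bullet> (y - z) = ?d \<bullet> (z - p)"
      by (simp add: inner_diff_left inner_diff_right inner_commute)
    then show ?thesis by (simp add: d)
  qed
  ultimately show ?thesis by simp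
qed

locale simple_system_3 = simple_system I n b P
  for I :: "'i set" and n :: "'i \<Rightarrow> real^3" and b P
begin

text \<open>A foot is the orthogonal projection of \<open>y\<close> to the flat of its face, so its
  active facets determine it. Hence there are finitely many normals, with a bound independent of
  \<open>y\<close>, as \<open>Max\<close> and \<open>card\<close> require.\<close>

lemma inj_on_act_normal_feet:
  assumes y: "y \<in> P"
  shows "inj_on act (normal_feet P y)"
proof (rule inj_onI)
  have perp: "w \<bullet> (y - z) = 0" if z: "z \<in> normal_feet P y" and w: "\<And>i. i \<in> act z \<Longrightarrow> n i \<bullet> w = 0" for z w
  proof -
    have zP: "z \<in> P" using z by (simp add: normal_feet_def)
    have "v \<bullet> (y - z) \<ge> 0" if v: "\<And>i. i \<in> act z \<Longrightarrow> n i \<bullet> v = 0" for v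
    proof -
      obtain e where e: "e > 0" "z + e *\<^sub>R v \<in> P" using feasible_direction[OF zP, of v] v by auto
      then have "e * (v \<bullet> (y - z)) \<ge> 0" using normal_foot_inner[OF y z e(2)] by simp
      then show ?thesis using e by (simp add: zero_le_mult_iff)
    qed
    from this[of w] this[of "- w"] w show ?thesis by simp
  qed
  fix z z' assume z: "z \<in> normal_feet P y" "z' \<in> normal_feet P y" and eq: "act z = act z'"
  have w: "n i \<bullet> (z' - z) = 0" if "i \<in> act z" for i
    using that that[unfolded eq] by (simp add: act_def inner_diff_right)
  have "(z' - z) \<bullet> (y - z) = 0" "(z' - z) \<bullet> (y - z') = 0"
    using perp z w eq by auto
  then have "(z' - z) \<bullet> (z' - z) = 0" by (simp add: inner_diff_right)
  then show "z = z'" by simp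
qed

lemma act_normal_feet_subset: "act ` normal_feet P y \<subseteq> Pow I"
  by (auto simp: act_def)

lemma finite_normal_feet: "y \<in> P \<Longrightarrow> finite (normal_feet P y)"
  using inj_on_finite[OF inj_on_act_normal_feet act_normal_feet_subset] finite_I by simp

lemma num_normals_le_max:
  assumes "y \<in> interior P"
  shows "num_normals P y \<le> max_normals P"
proof -
  have "num_normals P x \<le> card (Pow I)" if "x \<in> interior P" for x
  proof -
    have "x \<in> P" using that interior_subset by auto
    then show ?thesis
      using card_inj_on_le[OF inj_on_act_normal_feet act_normal_feet_subset] finite_I
      by (simp add: num_normals_def card_normals_from)
  qed
  then have "num_normals P ` interior P \<subseteq> {..card (Pow I)}" by (simp add: image_subset_iff)
  then have "finite (num_normals P ` interior P)" by (rule finite_subset) simp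
  then show ?thesis unfolding max_normals_def using assms by (intro Max_ge) auto
qed

text \<open>Strictly positive slacks let \<open>act\<close> recover \<open>J\<close> from its foot,
  so distinct cells give distinct feet. For nonempty \<open>J\<close> the foot differs from
  \<open>y\<close>, and the difference is normal to a support plane.\<close>

lemma card_cells_le_num_normals:
  assumes y: "\<And>i. i \<in> I \<Longrightarrow> crd {} i y > 0"
    and S: "\<And>J. J \<in> S \<Longrightarrow> J \<in> cells \<and> J \<noteq> {} \<and> (\<forall>i\<in>I. crd J i y > 0)"
  shows "card S \<le> num_normals P y"
proof -
  have yP: "y \<in> P" using y by (auto simp: in_P_iff crd_empty less_imp_le)
  have nonneg: "\<forall>i\<in>I. crd J i y \<ge> 0" if "J \<in> S" for J using S[OF that] by (auto simp: less_imp_le)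
  have act: "act (foot J y) = J" if "J \<in> S" for J
  proof -
    have "k \<in> J" if k: "k \<in> act (foot J y)" for k
    proof (rule ccontr)
      assume "k \<notin> J"
      then have "crd J k y = 0" using k by (simp add: crd_def act_def)
      then show False using S[OF \<open>J \<in> S\<close>] k by (auto simp: act_def)
    qed
    then show ?thesis using foot_in_P(2)[OF _ nonneg] S that by blast
  qed
  have "foot J y \<in> normal_feet P y" if J: "J \<in> S" for J
  proof -
    let ?z = "foot J y" let ?a = "foot J y - y"
    have zP: "?z \<in> P" using foot_in_P(1)[OF _ nonneg] S J by blast
    have C: "J \<in> cells" using S J by blast
    obtain j where j: "j \<in> J" using S J by blast
    then have "n j \<bullet> y > n j \<bullet> ?z"
      using y[of j] inner_foot[OF C j] cells_subset[OF C] by (auto simp: crd_empty)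
    then have a: "?a \<noteq> 0" by auto
    have "?a \<bullet> p \<le> ?a \<bullet> ?z" if p: "p \<in> P" for p
    proof -
      have "y - ?z = (\<Sum>j\<in>J. crd J j y *\<^sub>R n j)" by (rule foot_diff)
      then have "(y - ?z) \<bullet> (p - ?z) = (\<Sum>j\<in>J. crd J j y * (n j \<bullet> (p - ?z)))"
        by (simp add: inner_sum_left)
      also have "\<dots> \<ge> 0"
      proof (intro sum_nonneg mult_nonneg_nonneg)
        fix j assume j: "j \<in> J"
        then have "j \<in> I" using C cells_subset by auto
        then show "crd J j y \<ge> 0" "n j \<bullet> (p - ?z) \<ge> 0"
          using p inner_foot[OF C j] nonneg[OF J] by (auto simp: in_P_iff inner_diff_right)
      qed
      finally show ?thesis by (simp add: inner_diff_left inner_diff_right)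
    qed
    then have "support_plane P {x. ?a \<bullet> x = ?a \<bullet> ?z}"
      using a zP unfolding support_plane_def by blast
    moreover have "perp_to_plane y ?z {x. ?a \<bullet> x = ?a \<bullet> ?z}"
      by (simp add: perp_to_plane_def orthogonal_def inner_diff_right)
    ultimately show ?thesis using zP unfolding normal_feet_def by blast
  qed
  then have "(\<lambda>J. foot J y) ` S \<subseteq> normal_feet P y" by auto
  moreover have "inj_on (\<lambda>J. foot J y) S"
    by (rule inj_on_inverseI[of _ act]) (simp add: act)
  ultimately have "card S \<le> card (normal_feet P y)"
    using finite_normal_feet[OF yP] by (intro card_inj_on_le)
  then show ?thesis by (simp add: num_normals_def card_normals_from)
qed

text \<open>Good directions form a finite intersection of open half-spaces, so a generic one exists;
  three facets at \<open>V\<close> give \<open>2 ^ 3 + 2\<close>.\<close>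

theorem ten_normals:
  assumes V: "V \<in> P" "act V = {i, j, k}" and frame: "vertex_frame n w i j k"
    and w: "w i \<bullet> w j > 0" "w i \<bullet> w k > 0"
  shows "max_normals P \<ge> 10"
proof -
  interpret fr: vertex_frame n w i j k by (rule frame)
  define U where "U = {u. \<forall>J\<in>Pow (act V). \<forall>x\<in>act V. coord_lin n J x u > 0}"
  have "U = (\<Inter>J\<in>Pow (act V). \<Inter>x\<in>act V. {u. coord_grad n J x \<bullet> u > 0})"
    by (auto simp: U_def coord_lin_grad)
  moreover have "finite (act V)" by (simp add: V)
  ultimately have "open U"
    by (auto intro!: open_INT open_halfspace_gt)
  moreover have "U \<noteq> {}"
    using fr.exists_good_direction[OF w] by (auto simp: U_def V)
  ultimately have "\<exists>u\<in>U. \<forall>t>0. \<forall>J\<in>cells. (\<forall>k\<in>I. crd J k (V + t *\<^sub>R u) \<ge> 0) \<longrightarrow>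
    (\<forall>i\<in>I. crd J i (V + t *\<^sub>R u) = 0 \<longrightarrow>
      coord_lin n J i u \<noteq> 0 \<and> (\<forall>k\<in>I - {i}. crd J k (V + t *\<^sub>R u) \<noteq> 0))"
    by (rule exists_generic_ray)
  then obtain u where u: "u \<in> U"
    "\<forall>t>0. \<forall>J\<in>cells. (\<forall>k\<in>I. crd J k (V + t *\<^sub>R u) \<ge> 0) \<longrightarrow>
    (\<forall>i\<in>I. crd J i (V + t *\<^sub>R u) = 0 \<longrightarrow>
      coord_lin n J i u \<noteq> 0 \<and> (\<forall>k\<in>I - {i}. crd J k (V + t *\<^sub>R u) \<noteq> 0))"
    by (rule bexE)
  interpret ray: generic_ray I n b P V u
  proof
    show "V \<in> P" by fact
    show "v = 0" if "\<And>i. i \<in> act V \<Longrightarrow> n i \<bullet> v = 0" for v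
      using that fr.full by (simp add: V)
    show "coord_lin n J i u > 0" if "J \<subseteq> act V" "i \<in> act V" for J i
      using u that by (auto simp: U_def)
    show "coord_lin n J i u \<noteq> 0 \<and> (\<forall>k\<in>I - {i}. crd J k (V + t *\<^sub>R u) \<noteq> 0)"
      if "0 < t" "J \<in> cells" "\<forall>k\<in>I. crd J k (V + t *\<^sub>R u) \<ge> 0" "i \<in> I" "crd J i (V + t *\<^sub>R u) = 0" for t J i
      using bspec[OF mp[OF spec[OF u(2), of t] that(1)] that(2)] that(3-5) by auto
  qed
  obtain t where t: "t > 0" "{} \<in> ray.active t" "card (ray.active t - {{}}) \<ge> 2 ^ card (act V) + 2"
    using ray.many_active by auto
  let ?y = "V + t *\<^sub>R u"
  have y: "crd {} i ?y > 0" if "i \<in> I" for i using t that by (simp add: ray.active_def)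
  have "card (ray.active t - {{}}) \<le> num_normals P ?y"
    by (rule card_cells_le_num_normals[OF y]) (auto simp: ray.active_def)
  moreover have "card (act V) = 3" using fr.distinct by (simp add: V)
  ultimately have "10 \<le> num_normals P ?y" using t by simp
  moreover have "?y \<in> interior P"
  proof (rule interiorI)
    show "open (\<Inter>i\<in>I. {x. n i \<bullet> x > b i})"
      using finite_I by (intro open_INT) (auto intro: open_halfspace_gt)
    show "?y \<in> (\<Inter>i\<in>I. {x. n i \<bullet> x > b i})" using y by (simp add: crd_empty)
    show "(\<Inter>i\<in>I. {x. n i \<bullet> x > b i}) \<subseteq> P" by (auto simp: in_P_iff less_imp_le)
  qed
  ultimately show ?thesis using num_normals_le_max by fastforce
qed

end

section \<open>Facets of polytopes\<close>

text \<open>With one normal removed, too few are left for a trivial common kernel; a nonzero vector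
  there pairs nontrivially with the removed one.\<close>

lemma dual_family_of_full:
  fixes n :: "'i \<Rightarrow> 'a::euclidean_space"
  assumes "finite J" "card J = DIM('a)" and full: "\<And>v. (\<And>j. j \<in> J \<Longrightarrow> n j \<bullet> v = 0) \<Longrightarrow> v = 0"
  shows "dual_family n J"
  unfolding dual_family_def
proof (intro conjI ballI)
  fix j assume j: "j \<in> J"
  have "dim (n ` (J - {j})) \<le> card (n ` (J - {j}))" using assms by (intro dim_le_card') auto
  also have "\<dots> \<le> card (J - {j})" using assms by (intro card_image_le) auto
  also have "\<dots> < DIM('a)" using assms j by (metis card_Diff1_less)
  finally obtain v where v: "v \<noteq> 0" "\<And>y. y \<in> span (n ` (J - {j})) \<Longrightarrow> orthogonal v y"
    using orthogonal_to_subspace_exists by blast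
  have 0: "n k \<bullet> v = 0" if "k \<in> J" "k \<noteq> j" for k
    using v(2)[of "n k"] that by (auto simp: span_base orthogonal_def inner_commute)
  have nj: "n j \<bullet> v \<noteq> 0" using full[of v] 0 v(1) by metis
  then have "\<forall>k\<in>J. n k \<bullet> ((1 / (n j \<bullet> v)) *\<^sub>R v) = of_bool (k = j)" using 0 by auto
  then show "\<exists>w. \<forall>k\<in>J. n k \<bullet> w = of_bool (k = j)" by blast
qed (fact assms(1))

text \<open>A segment from an interior point to a point outside leaves \<open>P\<close> through a
  facet; its inequality is strict at the start, hence violated at the end. So the facet inequalities
  cut out \<open>P\<close>.\<close>

lemma polytope_facet_system:
  fixes P :: "'a::euclidean_space set"
  assumes P: "polytope P" "interior P \<noteq> {}"
  obtains n b where "facet_system {F. F facet_of P} n b P"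
    "\<And>F. F facet_of P \<Longrightarrow> F = {x\<in>P. n F \<bullet> x = b F}"
proof -
  have poly: "polyhedron P" using P polytope_imp_polyhedron by blast
  have "\<exists>a c. a \<noteq> 0 \<and> P \<subseteq> {x. c \<le> a \<bullet> x} \<and> F = P \<inter> {x. a \<bullet> x = c}" if F: "F facet_of P" for F
  proof -
    obtain a c where "a \<noteq> 0" "P \<subseteq> {x. a \<bullet> x \<le> c}" "F = P \<inter> {x. a \<bullet> x = c}"
      using facet_of_polyhedron[OF poly F] by blast
    then show ?thesis by (intro exI[of _ "- a"] exI[of _ "- c"]) auto
  qed
  then obtain n b where nb: "\<And>F. F facet_of P \<Longrightarrow> n F \<noteq> 0 \<and> P \<subseteq> {x. b F \<le> n F \<bullet> x} \<and> F = P \<inter> {x. n F \<bullet> x = b F}"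
    by metis
  have "x \<in> P" if x: "\<And>F. F facet_of P \<Longrightarrow> b F \<le> n F \<bullet> x" for x
  proof (rule ccontr)
    assume "x \<notin> P"
    obtain c where c: "c \<in> interior P" using P by blast
    have "closed_segment c x \<inter> frontier P \<noteq> {}"
      using c \<open>x \<notin> P\<close> interior_subset by (intro connected_Int_frontier) auto
    then obtain z where z: "z \<in> closed_segment c x" "z \<in> frontier P" by blast
    have "z \<in> P - rel_interior P"
      using z(2) P polyhedron_imp_closed[OF poly] by (simp add: frontier_def rel_interior_nonempty_interior)
    then obtain F where F: "F facet_of P" "z \<in> F" using rel_boundary_of_polyhedron[OF poly] by auto
    have "interior P \<subseteq> interior {x. n F \<bullet> x \<ge> b F}" using nb[OF F(1)] by (intro interior_mono) auto
    then have cF: "n F \<bullet> c > b F" using c nb[OF F(1)] by auto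
    obtain s where s: "0 \<le> s" "s \<le> 1" "z = (1 - s) *\<^sub>R c + s *\<^sub>R x" using z(1) by (auto simp: in_segment)
    have "n F \<bullet> z = b F" "z \<in> P" using F nb[OF F(1)] by auto
    then have "s \<noteq> 1" using s \<open>x \<notin> P\<close> by auto
    then have "(1 - s) * (n F \<bullet> c) > (1 - s) * b F" using s cF by simp
    moreover have "s * (n F \<bullet> x) \<ge> s * b F" using s x[OF F(1)] by (simp add: mult_left_mono)
    moreover have "n F \<bullet> z = (1 - s) * (n F \<bullet> c) + s * (n F \<bullet> x)" by (simp add: s inner_add_right)
    ultimately show False using \<open>n F \<bullet> z = b F\<close> by (simp add: algebra_simps)
  qed
  then have "facet_system {F. F facet_of P} n b P"
    using nb finite_polyhedron_facets[OF poly] by unfold_locales auto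
  then show thesis using that nb by blast
qed

text \<open>Counted by facets because it is their normals that have to be independent; checked
  directly for both combinatorial types.\<close>

definition three_facets_per_vertex :: "(real^3) set \<Rightarrow> bool" where
  "three_facets_per_vertex P \<longleftrightarrow> (\<forall>v. v extreme_point_of P \<longrightarrow> card {F. F facet_of P \<and> v \<in> F} = 3)"

text \<open>Independence at an arbitrary point is inherited from a vertex of the face cut out by its
  active facets, where at least the same facets are active.\<close>

lemma polytope_simple_system:
  fixes P :: "(real^3) set"
  assumes P: "polytope P" "interior P \<noteq> {}" and simple: "three_facets_per_vertex P"
  obtains n b where "simple_system_3 {F. F facet_of P} n b P"
    "\<And>F. F facet_of P \<Longrightarrow> F = {x\<in>P. n F \<bullet> x = b F}"
proof -
  obtain n b where sys: "facet_system {F. F facet_of P} n b P"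
    and eq: "\<And>F. F facet_of P \<Longrightarrow> F = {x\<in>P. n F \<bullet> x = b F}"
    using polytope_facet_system[OF P] by blast
  interpret facet_system "{F. F facet_of P}" n b P by (rule sys)
  have act: "act x = {F. F facet_of P \<and> x \<in> F}" if "x \<in> P" for x
    using eq that by (auto simp: act_def)
  have vertex: "dual_family n (act v)" if v: "v extreme_point_of P" for v
  proof (rule dual_family_of_full)
    have "v \<in> P" using v by (simp add: extreme_point_of_def)
    show "finite (act v)" using finite_I by (simp add: act_def)
    show "card (act v) = DIM(real^3)"
      using simple v \<open>v \<in> P\<close> by (simp add: three_facets_per_vertex_def act)
    show "w = 0" if "\<And>j. j \<in> act v \<Longrightarrow> n j \<bullet> w = 0" for w using extreme_point_full[OF v] that by blast
  qed
  have "dual_family n (act x)" if x: "x \<in> P" for x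
  proof -
    let ?G = "P \<inter> \<Inter>(act x)"
    have G: "?G face_of P"
    proof -
      have "T face_of P" if "T \<in> insert P (act x)" for T
        using that P(1) facet_of_imp_face_of face_of_refl polytope_imp_convex unfolding act_def by blast
      then have "\<Inter>(insert P (act x)) face_of P" by (intro face_of_Inter) auto
      then show ?thesis by simp
    qed
    have "compact ?G" "convex ?G" using G P face_of_imp_compact face_of_imp_convex polytope_imp_compact polytope_imp_convex by blast+
    moreover have "x \<in> ?G" using x by (auto simp: act)
    ultimately obtain v where v: "v extreme_point_of ?G" using extreme_point_exists_convex by blast
    then have "v extreme_point_of P" "v \<in> ?G" using extreme_point_of_face[OF G] by auto
    moreover have "act x \<subseteq> act v" using \<open>v \<in> ?G\<close> by (auto simp: act) (auto simp: act_def)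
    ultimately show ?thesis using vertex dual_family_subset by blast
  qed
  then have "simple_system_3 {F. F facet_of P} n b P"
    using P polytope_imp_bounded by unfold_locales auto
  then show thesis using that eq by blast
qed

definition facets_at :: "(real^3) set \<Rightarrow> real^3 \<Rightarrow> (real^3) set set" where
  "facets_at P v = {F. F facet_of P \<and> v \<in> F}"

section \<open>Planar angles at a vertex of a generic polytope\<close>

text \<open>\<open>G \<inter> H\<close> and \<open>F \<inter> H\<close> are edges of the facet
  \<open>H\<close>, so a vanishing product would be a right planar angle of \<open>H\<close> at
  \<open>V\<close>.\<close>

lemma not_orthogonal_edges:
  assumes gen: "generic P" and F: "F facet_of P" "G facet_of P" "H facet_of P"
    and sys: "facet_system {F. F facet_of P} n b P" "\<And>F. F facet_of P \<Longrightarrow> F = {x\<in>P. n F \<bullet> x = b F}"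
    and frame: "vertex_frame n w F G H"
    and V: "V extreme_point_of P" "V \<in> F" "V \<in> G" "V \<in> H"
    and p: "p \<in> G" "p \<in> H" "p \<notin> F" and q: "q \<in> F" "q \<in> H" "q \<notin> G"
  shows "(p - V) \<bullet> (q - V) \<noteq> 0"
proof
  assume orth: "(p - V) \<bullet> (q - V) = 0"
  have edge: "A \<inter> C edge_of C"
    if ABC: "A facet_of P" "B facet_of P" "C facet_of P" "V \<in> A" "V \<in> B" "V \<in> C" "r \<in> A" "r \<in> C" "r \<notin> B"
      "{A, B, C} = {F, G, H}"
    for A B C r
  proof -
    have AC: "A \<inter> C face_of C"
      using that by (intro face_of_subset[OF face_of_Int[of A P C]]) (auto simp: facet_of_def face_of_imp_subset)
    have full: "v = 0" if "n A \<bullet> v = 0" "n B \<bullet> v = 0" "n C \<bullet> v = 0" for v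
    proof -
      have "\<forall>X\<in>{F, G, H}. n X \<bullet> v = 0" unfolding ABC(10)[symmetric] using that by simp
      then show ?thesis by (intro vertex_frame.full[OF frame]) auto
    qed
    have val: "n X \<bullet> x = b X" if "X facet_of P" "x \<in> X" for x X using sys(2)[OF that(1)] that(2) by blast
    have "r \<in> P" using ABC facet_of_imp_subset by blast
    then have nr: "n B \<bullet> (r - V) \<noteq> 0"
      using sys(2)[OF ABC(2)] ABC val[OF ABC(2) ABC(5)] by (auto simp: inner_diff_right)
    have "A \<inter> C \<subseteq> affine hull {V, r}"
    proof
      fix x assume x: "x \<in> A \<inter> C"
      \<comment> \<open>On \<open>A \<inter> C\<close> the value of \<open>n B\<close> is a
        parameter, as the three normals have trivial common kernel.\<close>
      define s where "s = (n B \<bullet> (x - V)) / (n B \<bullet> (r - V))"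
      have "(x - V) - s *\<^sub>R (r - V) = 0"
        using x ABC nr by (intro full) (simp_all add: inner_diff_right val s_def)
      then have "x = V + s *\<^sub>R (r - V)" by (simp add: algebra_simps)
      then show "x \<in> affine hull {V, r}" by (auto simp: affine_hull_2_alt)
    qed
    then have "aff_dim (A \<inter> C) \<le> aff_dim {V, r}" by (metis aff_dim_affine_hull aff_dim_subset)
    moreover have "aff_dim {V, r} \<le> aff_dim (A \<inter> C)" using ABC by (intro aff_dim_subset) auto
    moreover have "V \<noteq> r" using ABC by auto
    ultimately have "aff_dim (A \<inter> C) = 1" by (simp add: aff_dim_2)
    then show ?thesis using AC by (simp add: edge_of_def)
  qed
  have "G \<inter> H edge_of H" by (rule edge[of G F H p]) (use F V p in auto)
  moreover have "F \<inter> H edge_of H" by (rule edge[of F G H q]) (use F V q in auto)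
  moreover have "V extreme_point_of H" using V F extreme_point_of_face facet_of_imp_face_of by blast
  ultimately have "right_planar_angle H V"
    unfolding right_planar_angle_def
    using V p q orth by (intro exI[of _ "G \<inter> H"] exI[of _ "F \<inter> H"] exI[of _ p] exI[of _ q]) (auto simp: orthogonal_def)
  then show False using gen F \<open>V extreme_point_of H\<close> by (auto simp: generic_def)
qed

text \<open>\<open>p\<close>, \<open>q\<close>, \<open>r\<close> lie on the three edges at
  \<open>V\<close>, and no product vanishes. If two are positive, the edge common to both is the
  distinguished one for \<open>ten_normals\<close>; otherwise two are negative.\<close>

lemma vertex_alternative:
  assumes gen: "generic P" and simple: "three_facets_per_vertex P"
    and V: "V extreme_point_of P" "facets_at P V = {F, G, H}"
    and p: "p \<in> G" "p \<in> H" "p \<notin> F" and q: "q \<in> F" "q \<in> H" "q \<notin> G" and r: "r \<in> F" "r \<in> G" "r \<notin> H"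
  shows "max_normals P \<ge> 10 \<or>
    (p - V) \<bullet> (q - V) < 0 \<and> (p - V) \<bullet> (r - V) < 0 \<or>
    (p - V) \<bullet> (q - V) < 0 \<and> (q - V) \<bullet> (r - V) < 0 \<or>
    (p - V) \<bullet> (r - V) < 0 \<and> (q - V) \<bullet> (r - V) < 0"
proof -
  have P: "polytope P" "interior P \<noteq> {}" using gen by (auto simp: generic_def simple_polytope_def solid_polytope_def)
  obtain n b where sys: "simple_system_3 {F. F facet_of P} n b P"
    and eq: "\<And>F. F facet_of P \<Longrightarrow> F = {x\<in>P. n F \<bullet> x = b F}"
    using polytope_simple_system[OF P simple] by blast
  interpret simple_system_3 "{F. F facet_of P}" n b P by (rule sys)
  have VP: "V \<in> P" using V by (simp add: extreme_point_of_def)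
  have facet: "F facet_of P" "G facet_of P" "H facet_of P" and VF: "V \<in> F" "V \<in> G" "V \<in> H"
    using V(2) by (auto simp: facets_at_def)
  have act_V: "act V = {F, G, H}" using eq VP V(2) by (auto simp: act_def facets_at_def)
  have val: "n X \<bullet> x = b X" if "X facet_of P" "x \<in> X" for x X using eq[OF that(1)] that(2) by blast
  have gt: "n X \<bullet> x > b X" if "X facet_of P" "x \<in> P" "x \<notin> X" for x X
    using eq[OF that(1)] that in_P_iff[of x] by (force simp: order_less_le)
  have in_P: "p \<in> P" "q \<in> P" "r \<in> P" using p q r facet facet_of_imp_subset by blast+
  have distinct: "F \<noteq> G" "G \<noteq> H" "F \<noteq> H" using p q r by auto
  define s where "s X = (if X = F then p else if X = G then q else r)" for X
  \<comment> \<open>Positive rescaling makes the edge vectors dual to the normals and keeps the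
    signs of their products.\<close>
  define w where "w X = (1 / (n X \<bullet> (s X - V))) *\<^sub>R (s X - V)" for X
  have npos: "n F \<bullet> (p - V) > 0" "n G \<bullet> (q - V) > 0" "n H \<bullet> (r - V) > 0"
    using gt[OF facet(1) in_P(1)] gt[OF facet(2) in_P(2)] gt[OF facet(3) in_P(3)] p q r val facet VF
    by (auto simp: inner_diff_right)
  have w: "w F = (1 / (n F \<bullet> (p - V))) *\<^sub>R (p - V)" "w G = (1 / (n G \<bullet> (q - V))) *\<^sub>R (q - V)"
    "w H = (1 / (n H \<bullet> (r - V))) *\<^sub>R (r - V)"
    using distinct by (auto simp: w_def s_def)
  have frame: "vertex_frame n w F G H"
  proof
    show "F \<noteq> G" "G \<noteq> H" "F \<noteq> H" by fact+
    show "n x \<bullet> w y = of_bool (x = y)" if "x \<in> {F, G, H}" "y \<in> {F, G, H}" for x y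
      using that distinct npos val facet VF p q r by (auto simp: w inner_diff_right)
    show "v = 0" if "n F \<bullet> v = 0" "n G \<bullet> v = 0" "n H \<bullet> v = 0" for v
      by (rule extreme_point_full[OF V(1)]) (use that in \<open>auto simp: act_V\<close>)
  qed
  have scale: "((1 / a) *\<^sub>R x) \<bullet> ((1 / c) *\<^sub>R y) > 0 \<longleftrightarrow> x \<bullet> y > 0" if "a > 0" "c > 0" for a c :: real and x y :: "real^3"
  proof -
    define k where "k = (1 / a) * (1 / c)"
    have "((1 / a) *\<^sub>R x) \<bullet> ((1 / c) *\<^sub>R y) = k * (x \<bullet> y)" by (simp add: k_def)
    moreover have "k > 0" using that by (simp add: k_def)
    ultimately show ?thesis by (simp add: zero_less_mult_iff)
  qed
  have sgn: "w F \<bullet> w G > 0 \<longleftrightarrow> (p - V) \<bullet> (q - V) > 0" "w F \<bullet> w H > 0 \<longleftrightarrow> (p - V) \<bullet> (r - V) > 0"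
    "w G \<bullet> w H > 0 \<longleftrightarrow> (q - V) \<bullet> (r - V) > 0"
    unfolding w using scale npos by blast+
  have f2: "vertex_frame n w G F H" "vertex_frame n w H F G" "vertex_frame n w G H F" "vertex_frame n w F H G"
    using frame by (auto simp: vertex_frame_def insert_commute)
  note fs = facet_system_axioms
  have "(p - V) \<bullet> (q - V) \<noteq> 0"
    by (rule not_orthogonal_edges[OF gen facet fs eq frame V(1) VF p q])
  moreover have "(p - V) \<bullet> (r - V) \<noteq> 0"
    by (rule not_orthogonal_edges[OF gen facet(1,3,2) fs eq f2(4) V(1) VF(1,3,2) p(2,1,3) r])
  moreover have "(q - V) \<bullet> (r - V) \<noteq> 0"
    by (rule not_orthogonal_edges[OF gen facet(2,3,1) fs eq f2(3) V(1) VF(2,3,1) q(2,1,3) r(2,1,3)])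
  moreover have "max_normals P \<ge> 10" if "(p - V) \<bullet> (q - V) > 0" "(p - V) \<bullet> (r - V) > 0"
    using ten_normals[OF VP act_V frame] that sgn by blast
  moreover have "max_normals P \<ge> 10" if "(p - V) \<bullet> (q - V) > 0" "(q - V) \<bullet> (r - V) > 0"
    by (rule ten_normals[OF VP _ f2(1)]) (use act_V that sgn in \<open>auto simp: inner_commute\<close>)
  moreover have "max_normals P \<ge> 10" if "(p - V) \<bullet> (r - V) > 0" "(q - V) \<bullet> (r - V) > 0"
    by (rule ten_normals[OF VP _ f2(2)]) (use act_V that sgn in \<open>auto simp: inner_commute\<close>)
  ultimately show ?thesis by argo
qed

section \<open>Tetrahedra and prisms\<close>

text \<open>The two products add up to the squared length of the side from \<open>p\<close> to
  \<open>q\<close>.\<close>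

lemma triangle_one_obtuse:
  fixes p q r :: "'a::real_inner"
  shows "\<not> ((q - p) \<bullet> (r - p) < 0 \<and> (p - q) \<bullet> (r - q) < 0)"
proof -
  have "(q - p) \<bullet> (r - p) + (p - q) \<bullet> (r - q) = (q - p) \<bullet> (q - p)"
    by (simp add: inner_diff_left inner_diff_right inner_commute)
  moreover have "(q - p) \<bullet> (q - p) \<ge> 0" by simp
  ultimately show ?thesis by linarith
qed

text \<open>With corners in cyclic order the four products add up to the squared norm of
  \<open>?v\<close>.\<close>

lemma quadrilateral_three_obtuse:
  fixes p q r s :: "'a::real_inner"
  shows "\<not> ((q - p) \<bullet> (s - p) < 0 \<and> (p - q) \<bullet> (r - q) < 0 \<and> (q - r) \<bullet> (s - r) < 0 \<and> (p - s) \<bullet> (r - s) < 0)"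
proof -
  let ?v = "q - p + (s - r)"
  have "(q - p) \<bullet> (s - p) + (p - q) \<bullet> (r - q) + (q - r) \<bullet> (s - r) + (p - s) \<bullet> (r - s) = ?v \<bullet> ?v"
    by (simp add: inner_diff_left inner_diff_right inner_add_left inner_add_right inner_commute)
  moreover have "?v \<bullet> ?v \<ge> 0" by simp
  ultimately show ?thesis by linarith
qed

lemma simplex_vertex_in_face:
  assumes "\<not> affine_dependent C" "v \<in> C" "c \<subseteq> C"
  shows "v \<in> convex hull c \<longleftrightarrow> v \<in> c"
proof
  assume v: "v \<in> convex hull c"
  show "v \<in> c"
  proof (rule ccontr)
    assume "v \<notin> c"
    then have "c \<subseteq> C - {v}" using assms by auto
    then have "v \<in> affine hull (C - {v})"
      using v convex_hull_subset_affine_hull[of c] hull_mono[of c "C - {v}" affine] by blast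
    then show False using assms by (auto simp: affine_dependent_def)
  qed
qed (rule hull_inc)

lemma simplex_faces_mono:
  assumes "\<not> affine_dependent C" "c \<subseteq> C" "c' \<subseteq> C"
  shows "convex hull c \<subseteq> convex hull c' \<longleftrightarrow> c \<subseteq> c'"
proof
  assume "convex hull c \<subseteq> convex hull c'"
  then show "c \<subseteq> c'"
    using simplex_vertex_in_face[OF assms(1) _ assms(3)] assms(2) hull_subset[of c convex] by blast
qed (rule hull_mono)

theorem tetrahedron_ten_normals:
  assumes tet: "tetrahedron P" and gen: "generic P"
  shows "max_normals P \<ge> 10"
proof -
  obtain C where C: "\<not> affine_dependent C" "card C = 4" "P = convex hull C"
    using tet by (auto simp: tetrahedron_def simplex_def)
  define F where "F u = convex hull (C - {u})" for u
  have mem: "v \<in> F u \<longleftrightarrow> v \<noteq> u" if "v \<in> C" "u \<in> C" for u v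
    using simplex_vertex_in_face[OF C(1) that(1), of "C - {u}"] that by (auto simp: F_def)
  have nonempty: "F u \<noteq> {}" if "u \<in> C" for u
  proof -
    have "\<not> C \<subseteq> {u}" using card_mono[of "{u}" C] C(2) by auto
    then obtain v where "v \<in> C" "v \<noteq> u" by auto
    then show ?thesis using mem that by auto
  qed
  have facet: "G facet_of P \<longleftrightarrow> (\<exists>u\<in>C. G = F u)" for G
    using nonempty facet_of_convex_hull_affine_independent[OF C(1)] by (auto simp: C(3) F_def)
  have ext: "v extreme_point_of P \<longleftrightarrow> v \<in> C" for v
    using extreme_point_of_convex_hull_affine_independent[OF C(1)] by (simp add: C(3))
  have inj: "inj_on F C" by (rule inj_onI) (use mem in blast)
  have at: "facets_at P v = F ` (C - {v})" if "v \<in> C" for v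
    using mem that by (auto simp: facets_at_def facet)
  have "card (facets_at P v) = 3" if "v \<in> C" for v
    using that C(2) card_image[OF inj_on_subset[OF inj, of "C - {v}"]] by (simp add: at)
  then have three: "three_facets_per_vertex P"
    by (simp add: three_facets_per_vertex_def facets_at_def ext)
  have alt: "max_normals P \<ge> 10 \<or>
    (x - v) \<bullet> (y - v) < 0 \<and> (x - v) \<bullet> (z - v) < 0 \<or>
    (x - v) \<bullet> (y - v) < 0 \<and> (y - v) \<bullet> (z - v) < 0 \<or>
    (x - v) \<bullet> (z - v) < 0 \<and> (y - v) \<bullet> (z - v) < 0"
    if "C = {v, x, y, z}" "distinct [v, x, y, z]" for v x y z
  proof (rule vertex_alternative[OF gen three])
    show "v extreme_point_of P" using ext that by simp
    have "C - {v} = {x, y, z}" using that by auto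
    then show "facets_at P v = {F x, F y, F z}" using at[of v] that by simp
    show "x \<in> F y" "x \<in> F z" "x \<notin> F x" "y \<in> F x" "y \<in> F z" "y \<notin> F y" "z \<in> F x" "z \<in> F y" "z \<notin> F z"
      using mem that by auto
  qed
  obtain s where s: "s \<in> C" using C(2) by fastforce
  then have "card (C - {s}) = 3" using C(2) by simp
  then obtain t u v where tuv: "C - {s} = {t, u, v}" "distinct [t, u, v]" by (auto simp: card_3_iff)
  then have stuv: "C = {s, t, u, v}" "distinct [s, t, u, v]" using s by auto
  define obt where "obt v x y \<longleftrightarrow> (x - v) \<bullet> (y - v) < 0" for v x y :: "real^3"
  have sym: "obt v x y \<longleftrightarrow> obt v y x" for v x y by (simp add: obt_def inner_commute)
  have tri: "\<not> (obt v x y \<and> obt x v y)" for v x y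
    using triangle_one_obtuse[of x v y] by (simp add: obt_def)
  have "max_normals P \<ge> 10 \<or> obt s t u \<and> obt s t v \<or> obt s t u \<and> obt s u v \<or> obt s t v \<and> obt s u v"
    using alt[of s t u v] stuv by (simp add: obt_def)
  moreover have "max_normals P \<ge> 10 \<or> obt t s u \<and> obt t s v \<or> obt t s u \<and> obt t u v \<or> obt t s v \<and> obt t u v"
    using alt[of t s u v] stuv by (auto simp: obt_def)
  moreover have "max_normals P \<ge> 10 \<or> obt u s t \<and> obt u s v \<or> obt u s t \<and> obt u t v \<or> obt u s v \<and> obt u t v"
    using alt[of u s t v] stuv by (auto simp: obt_def)
  moreover have "max_normals P \<ge> 10 \<or> obt v s t \<and> obt v s u \<or> obt v s t \<and> obt v t u \<or> obt v s u \<and> obt v t u"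
    using alt[of v s t u] stuv by (auto simp: obt_def)
  \<comment> \<open>Each triangle admits one obtuse angle; \<open>sym\<close> identifies the two
    orders of the arms.\<close>
  moreover note tri[of s t u] tri[of s u t] tri[of t u s] tri[of s t v] tri[of s v t] tri[of t v s]
    tri[of s u v] tri[of s v u] tri[of u v s] tri[of t u v] tri[of t v u] tri[of u v t]
    sym[of s u t] sym[of t u s] sym[of u t s] sym[of s v t] sym[of t v s] sym[of v t s]
    sym[of s v u] sym[of u v s] sym[of v u s] sym[of t v u] sym[of u v t] sym[of v u t]
  ultimately show ?thesis by argo
qed

text \<open>Combinatorial equivalence is only given as an order isomorphism of faces, so facets have
  to be described by inclusion alone.\<close>

lemma facet_of_iff_maximal:
  fixes P :: "'a::euclidean_space set"
  assumes "polyhedron P"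
  shows "F facet_of P \<longleftrightarrow> F face_of P \<and> F \<noteq> {} \<and> F \<noteq> P \<and> (\<forall>G. G face_of P \<longrightarrow> F \<subseteq> G \<longrightarrow> G \<noteq> P \<longrightarrow> G = F)"
proof (intro iffI conjI allI impI)
  assume F: "F facet_of P"
  then show face: "F face_of P" and ne: "F \<noteq> {}" and "F \<noteq> P" by (auto simp: facet_of_def)
  fix G assume G: "G face_of P" "F \<subseteq> G" "G \<noteq> P"
  then obtain G' where G': "G' facet_of P" "G \<subseteq> G'"
    using face_of_polyhedron_subset_facet[OF assms G(1)] ne by auto
  have "F face_of G'"
    using face_of_subset[OF face, of G'] G G' facet_of_imp_subset by blast
  moreover have "convex G'" using G' face_of_imp_convex facet_of_imp_face_of by blast
  moreover have "aff_dim F = aff_dim G'" using F G' by (simp add: facet_of_def)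
  ultimately have "F = G'" using face_of_aff_dim_lt by fastforce
  then show "G = F" using G G' by auto
next
  assume F: "F face_of P \<and> F \<noteq> {} \<and> F \<noteq> P \<and> (\<forall>G. G face_of P \<longrightarrow> F \<subseteq> G \<longrightarrow> G \<noteq> P \<longrightarrow> G = F)"
  then obtain G where G: "G facet_of P" "F \<subseteq> G"
    using face_of_polyhedron_subset_facet[OF assms] by metis
  then have "G face_of P" "G \<noteq> P" by (auto simp: facet_of_def)
  then show "F facet_of P" using F G by metis
qed

text \<open>\<open>C\<close> and \<open>D\<close> are the vertices of the model triangle and
  segment. \<open>S p\<close> is the quadrilateral facet missing the lateral edge over
  \<open>p\<close>, and \<open>T r\<close> the triangular facet missing the end
  \<open>r\<close>.\<close>

definition prism_labelling where
  "prism_labelling P C D a S T \<longleftrightarrow> card C = 3 \<and> card D = 2 \<and>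
    (\<forall>v. v extreme_point_of P \<longleftrightarrow> (\<exists>p\<in>C. \<exists>r\<in>D. v = a p r)) \<and>
    (\<forall>F. F facet_of P \<longleftrightarrow> (\<exists>p\<in>C. F = S p) \<or> (\<exists>r\<in>D. F = T r)) \<and>
    (\<forall>p\<in>C. \<forall>p'\<in>C. \<forall>r\<in>D. a p r \<in> S p' \<longleftrightarrow> p \<noteq> p') \<and>
    (\<forall>p\<in>C. \<forall>r\<in>D. \<forall>r'\<in>D. a p r \<in> T r' \<longleftrightarrow> r \<noteq> r')"

lemma prism_labelling_exists:
  assumes prism: "triangular_prism P"
  shows "\<exists>(C :: (real^2) set) (D :: real set) a S T. prism_labelling P C D a S T"
proof -
  obtain C :: "(real^2) set" and D :: "real set" where
    C: "\<not> affine_dependent C" "card C = 3" and D: "\<not> affine_dependent D" "card D = 2"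
    and eq: "combinatorially_equivalent P ((convex hull C) \<times> (convex hull D))"
    using prism unfolding triangular_prism_def simplex_def by auto
  have P: "polytope P" using prism by (simp add: triangular_prism_def solid_polytope_def)
  note poly = polytope_imp_polyhedron[OF P]
  define Q where "Q = (convex hull C) \<times> (convex hull D)"
  obtain f where f: "bij_betw f {F. F face_of P} {G. G face_of Q}"
    and ord: "\<And>F F'. F face_of P \<Longrightarrow> F' face_of P \<Longrightarrow> F \<subseteq> F' \<longleftrightarrow> f F \<subseteq> f F'"
    using eq unfolding combinatorially_equivalent_def Q_def by blast
  have inj: "F = F'" if "F face_of P" "F' face_of P" "f F = f F'" for F F'
    using ord that by blast
  have surj: "\<exists>F. F face_of P \<and> f F = G" if "G face_of Q" for G
  proof -
    have "G \<in> f ` {F. F face_of P}" using f that unfolding bij_betw_def by simp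
    then show ?thesis by auto
  qed
  have f_empty: "f {} = {}"
  proof -
    obtain X where "X face_of P" "f X = {}" using surj[of "{}"] by auto
    then show ?thesis using ord[of "{}" X] by auto
  qed
  \<comment> \<open>\<open>\<Phi> c d\<close> is the face of \<open>P\<close> matching a product of
    faces. Pairs of nonempty sets parametrise the nonempty faces; products with an empty factor all
    coincide.\<close>
  define \<Phi> where "\<Phi> c d = (SOME F. F face_of P \<and> f F = (convex hull c) \<times> (convex hull d))" for c d
  have \<Phi>: "\<Phi> c d face_of P" "f (\<Phi> c d) = (convex hull c) \<times> (convex hull d)" if "c \<subseteq> C" "d \<subseteq> D" for c d
  proof -
    have "((convex hull c) \<times> (convex hull d)) face_of Q"
      using that C D unfolding Q_def face_of_Times_eq
      by (auto simp: face_of_convex_hull_affine_independent)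
    then have "\<exists>F. F face_of P \<and> f F = (convex hull c) \<times> (convex hull d)" by (rule surj)
    from someI_ex[OF this]
    show "\<Phi> c d face_of P" "f (\<Phi> c d) = (convex hull c) \<times> (convex hull d)" unfolding \<Phi>_def by auto
  qed
  have mono: "\<Phi> c d \<subseteq> \<Phi> c' d' \<longleftrightarrow> c \<subseteq> c' \<and> d \<subseteq> d'"
    if "c \<subseteq> C" "d \<subseteq> D" "c' \<subseteq> C" "d' \<subseteq> D" "c \<noteq> {}" "d \<noteq> {}" for c d c' d'
    using that ord[OF \<Phi>(1) \<Phi>(1), of c d c' d'] simplex_faces_mono[OF C(1), of c c'] simplex_faces_mono[OF D(1), of d d']
    by (simp add: \<Phi>(2) times_subset_iff)
  have nonempty: "\<Phi> c d \<noteq> {}" if "c \<subseteq> C" "d \<subseteq> D" "c \<noteq> {}" "d \<noteq> {}" for c d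
  proof
    assume "\<Phi> c d = {}"
    then have "(convex hull c) \<times> (convex hull d) = {}" using \<Phi>(2)[OF that(1,2)] f_empty by simp
    then show False using that unfolding Times_empty by simp
  qed
  have all: "\<exists>c d. c \<subseteq> C \<and> d \<subseteq> D \<and> c \<noteq> {} \<and> d \<noteq> {} \<and> F = \<Phi> c d" if F: "F face_of P" "F \<noteq> {}" for F
  proof -
    have "f F face_of Q" using bij_betwE[OF f] F by blast
    then obtain c d where cd: "c \<subseteq> C" "d \<subseteq> D" "f F = (convex hull c) \<times> (convex hull d)"
      unfolding Q_def face_of_Times_decomp face_of_convex_hull_affine_independent[OF C(1)]
        face_of_convex_hull_affine_independent[OF D(1)] by blast
    have "f F \<noteq> {}" using inj[of F "{}"] F f_empty by auto
    then have "c \<noteq> {}" "d \<noteq> {}" using cd by auto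
    moreover have "F = \<Phi> c d" by (rule inj) (use F cd \<Phi> in auto)
    ultimately show ?thesis using cd by blast
  qed
  have top: "\<Phi> C D = P"
  proof -
    have "P face_of P" using P by (simp add: face_of_refl polytope_imp_convex)
    moreover have "P \<noteq> {}" using nonempty[of C D] \<Phi>(1)[of C D] C D face_of_imp_subset by force
    ultimately have "\<exists>c d. c \<subseteq> C \<and> d \<subseteq> D \<and> c \<noteq> {} \<and> d \<noteq> {} \<and> P = \<Phi> c d" by (rule all)
    then obtain c d where cd: "c \<subseteq> C" "d \<subseteq> D" "c \<noteq> {}" "d \<noteq> {}" "P = \<Phi> c d" by blast
    have "P \<subseteq> \<Phi> C D" unfolding cd(5) using mono[of c d C D] cd by simp
    moreover have "\<Phi> C D \<subseteq> P" using \<Phi>(1)[of C D] face_of_imp_subset by auto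
    ultimately show ?thesis by blast
  qed
  define a where "a p r = (THE v. \<Phi> {p} {r} = {v})" for p r
  \<comment> \<open>The isomorphism says nothing about points. An extreme point of this face is
    itself a face of \<open>P\<close> below it, and minimality of \<open>({p}, {r})\<close>
    identifies the two.\<close>
  have sing: "\<Phi> {p} {r} = {a p r}" if p: "p \<in> C" "r \<in> D" for p r
  proof -
    have face: "\<Phi> {p} {r} face_of P" using \<Phi> p by auto
    have "compact (\<Phi> {p} {r})" "convex (\<Phi> {p} {r})"
      using face_of_imp_compact[OF polytope_imp_convex[OF P] polytope_imp_compact[OF P] face]
        face_of_imp_convex[OF face] by auto
    moreover have "\<Phi> {p} {r} \<noteq> {}" using p by (intro nonempty) auto
    ultimately obtain v where v: "v extreme_point_of \<Phi> {p} {r}"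
      by (rule extreme_point_exists_convex)
    then have vP: "{v} face_of P" and sub: "{v} \<subseteq> \<Phi> {p} {r}"
      using extreme_point_of_face[OF face] by (auto simp: face_of_singleton)
    obtain c d where cd: "c \<subseteq> C" "d \<subseteq> D" "c \<noteq> {}" "d \<noteq> {}" "{v} = \<Phi> c d" using all[OF vP] by auto
    with sub have "c \<subseteq> {p}" "d \<subseteq> {r}" using mono[of c d "{p}" "{r}"] p by auto
    then have "c = {p}" "d = {r}" using cd by auto
    then have "\<Phi> {p} {r} = {v}" using cd by simp
    then show ?thesis by (simp add: a_def)
  qed
  have card_Diff: "C - {p} \<noteq> {}" "D - {r} \<noteq> {}" for p r
  proof -
    have "\<not> C \<subseteq> {p}" using card_mono[of "{p}" C] C(2) by auto
    then show "C - {p} \<noteq> {}" by auto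
    have "\<not> D \<subseteq> {r}" using card_mono[of "{r}" D] D(2) by auto
    then show "D - {r} \<noteq> {}" by auto
  qed
  have CD: "C \<noteq> {}" "D \<noteq> {}" using C D by auto
  have mem: "a p r \<in> \<Phi> c d \<longleftrightarrow> p \<in> c \<and> r \<in> d" if "p \<in> C" "r \<in> D" "c \<subseteq> C" "d \<subseteq> D" for p r c d
  proof -
    have "a p r \<in> \<Phi> c d \<longleftrightarrow> \<Phi> {p} {r} \<subseteq> \<Phi> c d" using sing[OF that(1,2)] by simp
    also have "\<dots> \<longleftrightarrow> {p} \<subseteq> c \<and> {r} \<subseteq> d" by (rule mono) (use that in auto)
    finally show ?thesis by simp
  qed
  have proper: "\<Phi> c d \<noteq> P" if "c \<subseteq> C" "d \<subseteq> D" "\<not> (C \<subseteq> c \<and> D \<subseteq> d)" for c d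
  proof
    assume "\<Phi> c d = P"
    then have "\<Phi> C D \<subseteq> \<Phi> c d" using top by simp
    moreover have "\<Phi> C D \<subseteq> \<Phi> c d \<longleftrightarrow> C \<subseteq> c \<and> D \<subseteq> d" by (rule mono) (use that CD in auto)
    ultimately show False using that(3) by blast
  qed
  have maximal: "\<Phi> c d facet_of P"
    if cd: "c \<subseteq> C" "d \<subseteq> D" "c \<noteq> {}" "d \<noteq> {}" "\<not> (C \<subseteq> c \<and> D \<subseteq> d)"
      and m: "\<And>c' d'. c \<subseteq> c' \<Longrightarrow> d \<subseteq> d' \<Longrightarrow> c' \<subseteq> C \<Longrightarrow> d' \<subseteq> D \<Longrightarrow> c' = C \<and> d' = D \<or> c' = c \<and> d' = d" for c d
    unfolding facet_of_iff_maximal[OF poly]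
  proof (intro conjI allI impI)
    show "\<Phi> c d face_of P" by (rule \<Phi>(1)[OF cd(1,2)])
    show "\<Phi> c d \<noteq> {}" by (rule nonempty[OF cd(1-4)])
    show "\<Phi> c d \<noteq> P" by (rule proper[OF cd(1,2,5)])
    fix G assume G: "G face_of P" "\<Phi> c d \<subseteq> G" "G \<noteq> P"
    then have "G \<noteq> {}" using nonempty[OF cd(1-4)] by blast
    then obtain c' d' where cd': "c' \<subseteq> C" "d' \<subseteq> D" "G = \<Phi> c' d'" using all[OF G(1)] by auto
    have "\<Phi> c d \<subseteq> \<Phi> c' d' \<longleftrightarrow> c \<subseteq> c' \<and> d \<subseteq> d'" by (rule mono) (use cd cd' in auto)
    then have "c' = C \<and> d' = D \<or> c' = c \<and> d' = d" using m[of c' d'] G(2) cd' by blast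
    then show "G = \<Phi> c d" using G(3) cd' top by auto
  qed
  have "prism_labelling P C D a (\<lambda>p. \<Phi> (C - {p}) D) (\<lambda>r. \<Phi> C (D - {r}))"
    unfolding prism_labelling_def
  proof (intro conjI allI ballI)
    show "card C = 3" "card D = 2" by fact+
    show "v extreme_point_of P \<longleftrightarrow> (\<exists>p\<in>C. \<exists>r\<in>D. v = a p r)" for v
    proof
      assume "v extreme_point_of P"
      then have vP: "{v} face_of P" by (simp add: face_of_singleton)
      obtain c d where cd: "c \<subseteq> C" "d \<subseteq> D" "c \<noteq> {}" "d \<noteq> {}" "{v} = \<Phi> c d" using all[OF vP] by auto
      then obtain p r where pr: "p \<in> c" "r \<in> d" by blast
      then have "p \<in> C" "r \<in> D" using cd by auto
      moreover from this pr have "a p r \<in> {v}" unfolding cd(5) using mem[of p r c d] cd(1,2) by blast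
      ultimately show "\<exists>p\<in>C. \<exists>r\<in>D. v = a p r" by blast
    next
      assume "\<exists>p\<in>C. \<exists>r\<in>D. v = a p r"
      then obtain p r where pr: "p \<in> C" "r \<in> D" "v = a p r" by blast
      then have "{v} face_of P" using sing[of p r] \<Phi>(1)[of "{p}" "{r}"] by simp
      then show "v extreme_point_of P" by (simp add: face_of_singleton)
    qed
    show "a p r \<in> \<Phi> (C - {p'}) D \<longleftrightarrow> p \<noteq> p'" if "p \<in> C" "p' \<in> C" "r \<in> D" for p p' r
by (subst mem) (use that in auto)
    show "a p r \<in> \<Phi> C (D - {r'}) \<longleftrightarrow> r \<noteq> r'" if "p \<in> C" "r \<in> D" "r' \<in> D" for p r r'
by (subst mem) (use that in auto)
    show "F facet_of P \<longleftrightarrow> (\<exists>p\<in>C. F = \<Phi> (C - {p}) D) \<or> (\<exists>r\<in>D. F = \<Phi> C (D - {r}))" for F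
    proof
      assume "F facet_of P"
      then have fm: "F face_of P \<and> F \<noteq> {} \<and> F \<noteq> P \<and> (\<forall>G. G face_of P \<longrightarrow> F \<subseteq> G \<longrightarrow> G \<noteq> P \<longrightarrow> G = F)"
        by (rule iffD1[OF facet_of_iff_maximal[OF poly]])
      then have F: "F face_of P" "F \<noteq> {}" "F \<noteq> P" by simp_all
      have max: "G = F" if "G face_of P" "F \<subseteq> G" "G \<noteq> P" for G using fm that by simp
      obtain c d where cd: "c \<subseteq> C" "d \<subseteq> D" "c \<noteq> {}" "d \<noteq> {}" "F = \<Phi> c d" using all[OF F(1,2)] by auto
      have "c \<noteq> C \<or> d \<noteq> D" using F(3) cd(5) top by auto
      then have "(\<exists>p\<in>C. p \<notin> c) \<or> (\<exists>r\<in>D. r \<notin> d)" using cd(1,2) by blast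
      then consider p where "p \<in> C" "p \<notin> c" | r where "r \<in> D" "r \<notin> d" by blast
      then show "(\<exists>p\<in>C. F = \<Phi> (C - {p}) D) \<or> (\<exists>r\<in>D. F = \<Phi> C (D - {r}))"
      proof cases
        case 1
        have "\<Phi> (C - {p}) D = F"
        proof (rule max)
          show "\<Phi> (C - {p}) D face_of P" by (rule \<Phi>(1)) auto
          show "F \<subseteq> \<Phi> (C - {p}) D" unfolding cd(5) by (subst mono) (use 1 cd in auto)
          show "\<Phi> (C - {p}) D \<noteq> P" by (rule proper) (use 1 in auto)
        qed
        then show ?thesis using 1 by blast
      next
        case 2
        have "\<Phi> C (D - {r}) = F"
        proof (rule max)
          show "\<Phi> C (D - {r}) face_of P" by (rule \<Phi>(1)) auto
          show "F \<subseteq> \<Phi> C (D - {r})" unfolding cd(5) by (subst mono) (use 2 cd in auto)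
          show "\<Phi> C (D - {r}) \<noteq> P" by (rule proper) (use 2 in auto)
        qed
        then show ?thesis using 2 by blast
      qed
    next
      assume "(\<exists>p\<in>C. F = \<Phi> (C - {p}) D) \<or> (\<exists>r\<in>D. F = \<Phi> C (D - {r}))"
      then consider p where "p \<in> C" "F = \<Phi> (C - {p}) D" | r where "r \<in> D" "F = \<Phi> C (D - {r})" by blast
      then show "F facet_of P"
      proof cases
        case 1
        have "\<Phi> (C - {p}) D facet_of P"
          by (rule maximal) (use 1 card_Diff(1)[of p] CD in blast)+
        then show ?thesis using 1 by simp
      next
        case 2
        have "\<Phi> C (D - {r}) facet_of P"
          by (rule maximal) (use 2 card_Diff(2)[of r] CD in blast)+
        then show ?thesis using 2 by simp
      qed
    qed
  qed
  then show ?thesis by blast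
qed

theorem prism_ten_normals:
  assumes prism: "triangular_prism P" and gen: "generic P"
  shows "max_normals P \<ge> 10"
proof -
  obtain C :: "(real^2) set" and D :: "real set" and a S T where L: "prism_labelling P C D a S T"
    using prism_labelling_exists[OF prism] by blast
  have card: "card C = 3" "card D = 2" using L by (simp_all add: prism_labelling_def)
  have ext: "v extreme_point_of P \<longleftrightarrow> (\<exists>p\<in>C. \<exists>r\<in>D. v = a p r)" for v
    using L by (simp add: prism_labelling_def)
  have facet: "F facet_of P \<longleftrightarrow> (\<exists>p\<in>C. F = S p) \<or> (\<exists>r\<in>D. F = T r)" for F
    using L by (simp add: prism_labelling_def)
  have side: "a p r \<in> S p' \<longleftrightarrow> p \<noteq> p'" if "p \<in> C" "p' \<in> C" "r \<in> D" for p p' r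
    using L that by (simp add: prism_labelling_def)
  have base: "a p r \<in> T r' \<longleftrightarrow> r \<noteq> r'" if "p \<in> C" "r \<in> D" "r' \<in> D" for p r r'
    using L that by (simp add: prism_labelling_def)
  have at_image: "facets_at P (a p r) = S ` (C - {p}) \<union> T ` (D - {r})" if "p \<in> C" "r \<in> D" for p r
    using side[OF that(1) _ that(2)] base[OF that] by (auto simp: facets_at_def facet)
  have at: "facets_at P (a p r) = {S x, S y, T t}"
    if C: "C = {p, x, y}" "distinct [p, x, y]" and D: "D = {r, t}" "r \<noteq> t" for p x y r t
  proof -
    have "C - {p} = {x, y}" "D - {r} = {t}" "p \<in> C" "r \<in> D" using that by auto
    then show ?thesis using at_image[of p r] by (simp only: image_insert image_empty) blast
  qed
  have relabel: "\<exists>x y t. C = {p, x, y} \<and> distinct [p, x, y] \<and> D = {r, t} \<and> r \<noteq> t" if "p \<in> C" "r \<in> D" for p r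
  proof -
    have "card (C - {p}) = 2" "card (D - {r}) = 1" using that card by auto
    then obtain x y t where "C - {p} = {x, y}" "x \<noteq> y" "D - {r} = {t}"
      by (auto simp: card_2_iff card_1_singleton_iff)
    then show ?thesis using that by (intro exI[of _ x] exI[of _ y] exI[of _ t]) auto
  qed
  have three: "three_facets_per_vertex P"
    unfolding three_facets_per_vertex_def
  proof (intro allI impI)
    fix v assume "v extreme_point_of P"
    then obtain p r where v: "p \<in> C" "r \<in> D" "v = a p r" using ext by blast
    obtain x y t where xyt: "C = {p, x, y}" "distinct [p, x, y]" "D = {r, t}" "r \<noteq> t"
      using relabel v by blast
    have "a x r \<in> S y" "a x r \<notin> S x" "a p t \<in> S x" "a p t \<in> S y" "a p t \<notin> T t"
      using side[of x x r] side[of x y r] side[of p x t] side[of p y t] base[of p t t] xyt by auto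
    then have "S x \<noteq> S y" "S x \<noteq> T t" "S y \<noteq> T t" by auto
    then show "card {F. F facet_of P \<and> v \<in> F} = 3"
      using at[OF xyt] v by (simp add: facets_at_def)
  qed
  define obt where "obt v x y \<longleftrightarrow> (x - v) \<bullet> (y - v) < 0" for v x y :: "real^3"
  \<comment> \<open>The neighbours of \<open>a p r\<close> are the other two vertices of its
    triangle and the other end \<open>a p t\<close> of its lateral edge.\<close>
  have alt: "max_normals P \<ge> 10 \<or>
      obt (a p r) (a x r) (a y r) \<and> obt (a p r) (a x r) (a p t) \<or>
      obt (a p r) (a x r) (a y r) \<and> obt (a p r) (a y r) (a p t) \<or>
      obt (a p r) (a x r) (a p t) \<and> obt (a p r) (a y r) (a p t)"
    if C: "C = {p, x, y}" "distinct [p, x, y]" and D: "D = {r, t}" "r \<noteq> t" for p x y r t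
    unfolding obt_def
  proof (rule vertex_alternative[OF gen three])
    show "a p r extreme_point_of P" using ext that by auto
    show "facets_at P (a p r) = {S x, S y, T t}" by (rule at[OF that])
    show "a x r \<in> S y" "a x r \<in> T t" "a x r \<notin> S x" "a y r \<in> S x" "a y r \<in> T t" "a y r \<notin> S y"
      "a p t \<in> S x" "a p t \<in> S y" "a p t \<notin> T t"
      using side base that by auto
  qed
  have sym: "obt v x y \<longleftrightarrow> obt v y x" for v x y by (simp add: obt_def inner_commute)
  have tri: "\<not> (obt v x y \<and> obt x v y)" for v x y
    using triangle_one_obtuse[of x v y] by (simp add: obt_def)
  have quad: "\<not> (obt p q s \<and> obt q p r \<and> obt r q s \<and> obt s p r)" for p q r s
    using quadrilateral_three_obtuse[of q p s r] by (simp add: obt_def)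
  obtain p x y where pxy: "C = {p, x, y}" "distinct [p, x, y]"
    using card(1) by (auto simp: card_3_iff)
  obtain r t where rt: "D = {r, t}" "r \<noteq> t" using card(2) by (auto simp: card_2_iff)
  have perm: "C = {x, p, y}" "distinct [x, p, y]" "C = {y, p, x}" "distinct [y, p, x]" "D = {t, r}" "t \<noteq> r"
    using pxy rt by auto
  \<comment> \<open>In each \<open>quad\<close> fact the arguments are a corner, its two neighbours
    and the opposite corner of a lateral facet.\<close>
  show ?thesis
    using alt[OF pxy rt] alt[OF perm(1,2) rt] alt[OF perm(3,4) rt]
      alt[OF pxy perm(5,6)] alt[OF perm(1,2,5,6)] alt[OF perm(3-6)]
      tri[of "a p r" "a x r" "a y r"] tri[of "a p r" "a y r" "a x r"] tri[of "a x r" "a y r" "a p r"]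
      tri[of "a p t" "a x t" "a y t"] tri[of "a p t" "a y t" "a x t"] tri[of "a x t" "a y t" "a p t"]
      quad[of "a p r" "a x r" "a p t" "a x t"] quad[of "a p r" "a y r" "a p t" "a y t"]
      quad[of "a x r" "a y r" "a x t" "a y t"]
      sym[of "a p r" "a x r" "a y r"] sym[of "a x r" "a p r" "a y r"] sym[of "a y r" "a p r" "a x r"]
      sym[of "a p t" "a x t" "a y t"] sym[of "a x t" "a p t" "a y t"] sym[of "a y t" "a p t" "a x t"]
      sym[of "a p t" "a x t" "a p r"] sym[of "a x t" "a p t" "a x r"] sym[of "a p t" "a y t" "a p r"]
      sym[of "a y t" "a p t" "a y r"] sym[of "a x t" "a y t" "a x r"] sym[of "a y t" "a x t" "a y r"]
    by argo
qed

theorem proposition6: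
  "(\<forall>P :: (real^3) set. triangular_prism P \<and> generic P \<longrightarrow> max_normals P \<ge> 10) \<and>
   (\<forall>P :: (real^3) set. tetrahedron P \<and> generic P \<longrightarrow> max_normals P \<ge> 10)"
  using prism_ten_normals tetrahedron_ten_normals by blast

end
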